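(* Let $g\in C_c(\mathbb{R}_+)$ and $T>0$. For $t\in[0,T]$ put $t^{(m)}:=\lfloor t2^{2m}\rfloor 2^{-2m}$. Then, as $m\to\infty$, the discrete price converges to the Black--Scholes price uniformly for $t\in[0,T]$ and $x>0$: $$\lim_{m\to\infty} f_m(t^{(m)},x)=\lim_{m\to\infty}\mathbb{E}_{\mathbb{Q}_m}\left(r_m^{\lfloor t2^{2m}\rfloor-\lfloor T2^{2m}\rfloor}\,g(S_m(T^{(m)}))\,\middle|\,S_m(t^{(m)})=x\right)=\mathbb{E}_{\mathbb{Q}}\left(e^{-r(T-t)}g(S(T))\,\middle|\,S(t)=x\right)=f(t,x).$$ That is, $\lim_{m\to\infty}\sup_{t\in[0,T],\,x>0}|f_m(t^{(m)},x)-f(t,x)|=0$.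
   Context: $\mathbb{R}_+=[0,\infty)$; $C_c(\mathbb{R}_+)$ is the set of continuous real functions on $\mathbb{R}_+$ with compact support. Fixed parameters: $\mu\in\mathbb{R}$, $\sigma>0$, $r>0$. Discrete model. For an integer $m\ge0$ let $\Delta t=2^{-2m}$, $t_k=k\Delta t$, $N=\lfloor T2^{2m}\rfloor$, $r_m=1+r2^{-2m}$, $u_m=1+\sigma2^{-m}+\mu2^{-2m}$, $d_m=1-\sigma2^{-m}+\mu2^{-2m}$, and $$q_m^{\pm}=\frac12\pm\frac12\frac{r-\mu}{\sigma}2^{-m}.$$ Only $m$ so large that $0<q_m^+<1$ (and $d_m>0$) are considered. Under $\mathbb{Q}_m$ the discrete stock price $S_m(t_k)$ is the time-homogeneous Markov chain for which the ratios $S_m(t_{k+1})/S_m(t_k)$ are independent and equal $u_m$ with probability $q_m^+$ and $d_m$ with probability $q_m^-$. Hence, for any $x>0$ and $0\le k\le N$, $$f_m(t_k,x):=r_m^{k-N}\,\mathbb{E}_{\mathbb{Q}_m}(g(S_m(t_N))\mid S_m(t_k)=x)=r_m^{k-N}\sum_{i=0}^{N-k}\binom{N-k}{i}(q_m^+)^i(q_m^-)^{N-k-i}g(xu_m^id_m^{N-k-i}).$$ Continuous (Black--Scholes) model. Under $\mathbb{Q}$ the stock price is $S(t)=s_0\exp((r-\sigma^2/2)t+\sigma W(t))$, with $s_0>0$ and $W$ a $\mathbb{Q}$-Brownian motion. For $x>0$, $0\le t\le T$, $$f(t,x):=\mathbb{E}_{\mathbb{Q}}(e^{-r(T-t)}g(S(T))\mid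 S(t)=x)=e^{-r(T-t)}\,\mathbb{E}_{\mathbb{Q}}\left[g\left(x\,e^{(r-\sigma^2/2)(T-t)+\sigma W(T-t)}\right)\right].$$ *)

theory Defs
  imports "HOL-Probability.Probability"
begin

text \<open>Only the values on \<open>[0,\<infinity>)\<close> matter; since \<open>[0,\<infinity>)\<close> is closed, the closure taken in the
  reals is the support of the restriction.\<close>

definition Cc_nonneg :: "(real \<Rightarrow> real) set" where
  "Cc_nonneg = {g. continuous_on {0..} g \<and> compact (closure {x \<in> {0..}. g x \<noteq> 0})}"

definition grid_index :: "nat \<Rightarrow> real \<Rightarrow> nat" where
  "grid_index m t = nat \<lfloor>t * 2 ^ (2 * m)\<rfloor>"

definition rate_factor :: "real \<Rightarrow> nat \<Rightarrow> real" where
  "rate_factor r m = 1 + r / 2 ^ (2 * m)"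

definition up_factor :: "real \<Rightarrow> real \<Rightarrow> nat \<Rightarrow> real" where
  "up_factor \<mu> \<sigma> m = 1 + \<sigma> / 2 ^ m + \<mu> / 2 ^ (2 * m)"

definition down_factor :: "real \<Rightarrow> real \<Rightarrow> nat \<Rightarrow> real" where
  "down_factor \<mu> \<sigma> m = 1 - \<sigma> / 2 ^ m + \<mu> / 2 ^ (2 * m)"

definition q_plus :: "real \<Rightarrow> real \<Rightarrow> real \<Rightarrow> nat \<Rightarrow> real" where
  "q_plus \<mu> \<sigma> r m = 1 / 2 + 1 / 2 * ((r - \<mu>) / \<sigma>) / 2 ^ m"

definition q_minus :: "real \<Rightarrow> real \<Rightarrow> real \<Rightarrow> nat \<Rightarrow> real" where
  "q_minus \<mu> \<sigma> r m = 1 / 2 - 1 / 2 * ((r - \<mu>) / \<sigma>) / 2 ^ m"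

definition admissible :: "real \<Rightarrow> real \<Rightarrow> real \<Rightarrow> nat \<Rightarrow> bool" where
  "admissible \<mu> \<sigma> r m \<longleftrightarrow> 0 < q_plus \<mu> \<sigma> r m \<and> q_plus \<mu> \<sigma> r m < 1 \<and> 0 < down_factor \<mu> \<sigma> m"

text \<open>\<open>S k\<close> is the stock price at time \<open>k * 2 ^ (- 2 * m)\<close>, observed up to the horizon \<open>T\<close> and
  started at the constant \<open>s\<close>. Strict positivity on all of the space, and not just almost surely,
  keeps \<open>g \<circ> S k\<close> measurable for \<open>g\<close> that is only controlled on \<open>[0,\<infinity>)\<close>.\<close>

definition discrete_stock ::
  "real \<Rightarrow> real \<Rightarrow> real \<Rightarrow> real \<Rightarrow> nat \<Rightarrow> real \<Rightarrow> 'b measure \<Rightarrow> (nat \<Rightarrow> 'b \<Rightarrow> real) \<Rightarrow> bool" where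
  "discrete_stock \<mu> \<sigma> r T m s Q S \<longleftrightarrow>
     prob_space Q \<and>
     (\<forall>k\<le>grid_index m T. S k \<in> borel_measurable Q \<and> (\<forall>\<omega>\<in>space Q. S k \<omega> > 0)) \<and>
     (\<forall>\<omega>\<in>space Q. S 0 \<omega> = s) \<and>
     prob_space.indep_vars Q (\<lambda>_. borel) (\<lambda>k \<omega>. S (Suc k) \<omega> / S k \<omega>) {..<grid_index m T} \<and>
     (\<forall>k<grid_index m T.
        measure Q {\<omega> \<in> space Q. S (Suc k) \<omega> / S k \<omega> = up_factor \<mu> \<sigma> m} = q_plus \<mu> \<sigma> r m \<and>
        measure Q {\<omega> \<in> space Q. S (Suc k) \<omega> / S k \<omega> = down_factor \<mu> \<sigma> m} = q_minus \<mu> \<sigma> r m)"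

text \<open>The function \<open>f\<^sub>m\<close> at the grid time \<open>k * 2 ^ (- 2 * m)\<close>, for every \<open>x > 0\<close>, whether or not a
  given chain reaches \<open>x\<close>.\<close>

definition discrete_price ::
  "real \<Rightarrow> real \<Rightarrow> real \<Rightarrow> real \<Rightarrow> (real \<Rightarrow> real) \<Rightarrow> nat \<Rightarrow> nat \<Rightarrow> real \<Rightarrow> real" where
  "discrete_price \<mu> \<sigma> r T g m k x =
     (let N = grid_index m T in
      rate_factor r m powi (int k - int N) *
      (\<Sum>i=0..N - k. real ((N - k) choose i) * q_plus \<mu> \<sigma> r m ^ i * q_minus \<mu> \<sigma> r m ^ (N - k - i) *
         g (x * up_factor \<mu> \<sigma> m ^ i * down_factor \<mu> \<sigma> m ^ (N - k - i))))"

definition brownian_motion :: "'a measure \<Rightarrow> (real \<Rightarrow> 'a \<Rightarrow> real) \<Rightarrow> bool" where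
  "brownian_motion M W \<longleftrightarrow>
     prob_space M \<and>
     (\<forall>t\<ge>0. W t \<in> borel_measurable M) \<and>
     (AE \<omega> in M. W 0 \<omega> = 0) \<and>
     (\<forall>n (t :: nat \<Rightarrow> real). 0 \<le> t 0 \<and> (\<forall>i<n. t i \<le> t (Suc i)) \<longrightarrow>
        prob_space.indep_vars M (\<lambda>_. borel) (\<lambda>i \<omega>. W (t (Suc i)) \<omega> - W (t i) \<omega>) {..<n}) \<and>
     (\<forall>s t. 0 \<le> s \<and> s < t \<longrightarrow>
        distributed M lborel (\<lambda>\<omega>. W t \<omega> - W s \<omega>) (normal_density 0 (sqrt (t - s)))) \<and>
     (AE \<omega> in M. continuous_on {0..} (\<lambda>t. W t \<omega>))"

definition bs_stock ::
  "real \<Rightarrow> real \<Rightarrow> real \<Rightarrow> (real \<Rightarrow> 'a \<Rightarrow> real) \<Rightarrow> real \<Rightarrow> 'a \<Rightarrow> real" where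
  "bs_stock \<sigma> r s\<^sub>0 W t \<omega> = s\<^sub>0 * exp ((r - \<sigma>\<^sup>2 / 2) * t + \<sigma> * W t \<omega>)"

definition bs_price ::
  "real \<Rightarrow> real \<Rightarrow> real \<Rightarrow> (real \<Rightarrow> real) \<Rightarrow> 'a measure \<Rightarrow> (real \<Rightarrow> 'a \<Rightarrow> real) \<Rightarrow> real \<Rightarrow> real \<Rightarrow> real" where
  "bs_price \<sigma> r T g M W t x =
     exp (- r * (T - t)) *
     (\<integral>\<omega>. g (x * exp ((r - \<sigma>\<^sup>2 / 2) * (T - t) + \<sigma> * W (T - t) \<omega>)) \<partial>M)"

end

theory Submission
  imports Defs "HOL-Real_Asymp.Real_Asymp"
begin

text \<open>Uniform convergence is proved by Lindeberg's method in the variable \<open>y = ln x\<close>. There \<open>g\<close> becomes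
  the bounded, uniformly continuous function \<open>h y = g (exp y)\<close>, one step of the binomial model becomes
  an average \<open>A\<close> of two translations, and the Black--Scholes model becomes the semigroup \<open>P\<^sub>\<tau>\<close> of a
  Brownian motion with drift. Replacing \<open>h\<close> by a \<open>C\<^sup>3\<close> function \<open>F\<close> (an iterated moving average) costs
  an arbitrarily small error, because both operators are contractions in the supremum norm. The choice
  of \<open>q\<^sub>m\<close> matches the first two moments up to \<open>o(\<Delta>t)\<close>, so Taylor's formula gives
  \<open>sup \<bar>A F - P\<^sub>\<Delta>\<^sub>t F\<bar> = o(\<Delta>t)\<close>. As \<open>A\<close> and \<open>P\<close> commute, the error after \<open>n \<le> T / \<Delta>t\<close> steps is at most
  \<open>n\<close> times this, uniformly in \<open>n\<close> and \<open>y\<close>. The two conditional expectation formulas follow from the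
  independence of the ratios and of the increments, respectively.\<close>

subsection \<open>Smoothing of uniformly continuous functions\<close>

text \<open>With an antiderivative \<open>\<Phi>\<close> of \<open>f\<close>, take
  \<open>(\<Phi> (y + \<delta>) - \<Phi> y) / \<delta>\<close>. Averaging gains one derivative, and
  by the mean value theorem each average is a nearby value of \<open>f\<close>, so bounds and
  closeness pass on without any integral estimate.\<close>

lemma ex_moving_average:
  fixes f :: "real \<Rightarrow> real"
  assumes f: "continuous_on UNIV f" and "\<delta> > 0"
  obtains F where
    "\<And>y. (F has_real_derivative (f (y + \<delta>) - f y) / \<delta>) (at y)"
    "\<And>y. \<exists>\<xi>\<in>{y..y + \<delta>}. F y = f \<xi>"
proof -
  have "isCont f x" for x
    using f by (simp add: continuous_on_eq_continuous_at)
  then obtain \<Phi> where "\<And>x. (\<Phi> has_vector_derivative f x) (at x)"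
    using einterval_antiderivative[of "-\<infinity>" "\<infinity>" f] by auto
  then have \<Phi>: "\<And>x. (\<Phi> has_real_derivative f x) (at x)"
    by (simp add: has_real_derivative_iff_has_vector_derivative)
  show thesis
  proof
    fix y
    have "((\<lambda>y. \<Phi> (y + \<delta>)) has_real_derivative f (y + \<delta>)) (at y)"
      using \<Phi>[of "y + \<delta>"] by (subst (asm) DERIV_shift)
    with \<Phi> \<open>\<delta> > 0\<close>
    show "((\<lambda>y. (\<Phi> (y + \<delta>) - \<Phi> y) / \<delta>) has_real_derivative (f (y + \<delta>) - f y) / \<delta>) (at y)"
      by (auto intro!: derivative_eq_intros)
    from MVT2[of y "y + \<delta>" \<Phi> f] \<open>\<delta> > 0\<close> \<Phi>
    obtain \<xi> where "y < \<xi>" "\<xi> < y + \<delta>" "\<Phi> (y + \<delta>) - \<Phi> y = \<delta> * f \<xi>" by auto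
    with \<open>\<delta> > 0\<close> show "\<exists>\<xi>\<in>{y..y + \<delta>}. (\<Phi> (y + \<delta>) - \<Phi> y) / \<delta> = f \<xi>"
      by (intro bexI[of _ \<xi>]) auto
  qed
qed

lemma abs_diff_quotient_le:
  fixes f :: "real \<Rightarrow> real"
  assumes "\<And>y. \<bar>f y\<bar> \<le> B" "\<delta> > 0"
  shows "\<bar>(f (y + \<delta>) - f y) / \<delta>\<bar> \<le> 2 * B / \<delta>"
proof -
  have "\<bar>f (y + \<delta>) - f y\<bar> \<le> 2 * B"
    using assms(1)[of y] assms(1)[of "y + \<delta>"] by linarith
  then show ?thesis
    using \<open>\<delta> > 0\<close> by (simp add: divide_right_mono)
qed

lemma DERIV_diff_quotient:
  fixes f f' :: "real \<Rightarrow> real"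
  assumes "\<And>y. (f has_real_derivative f' y) (at y)" "\<delta> > 0"
  shows "((\<lambda>y. (f (y + \<delta>) - f y) / \<delta>) has_real_derivative (f' (y + \<delta>) - f' y) / \<delta>) (at y)"
proof -
  have "((\<lambda>y. f (y + \<delta>)) has_real_derivative f' (y + \<delta>)) (at y)"
    using assms(1)[of "y + \<delta>"] by (subst (asm) DERIV_shift)
  with assms show ?thesis by (auto intro!: derivative_eq_intros)
qed

text \<open>The derivatives are explicit arguments and share one bound with the function, so that
  all later error terms carry a single factor \<open>K\<close>. The bound on \<open>F3\<close>
  serves the Lagrange remainder.\<close>

definition C3_bounded_by ::
  "real \<Rightarrow> (real \<Rightarrow> real) \<Rightarrow> (real \<Rightarrow> real) \<Rightarrow> (real \<Rightarrow> real) \<Rightarrow> (real \<Rightarrow> real) \<Rightarrow> bool" where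
  "C3_bounded_by K F F1 F2 F3 \<longleftrightarrow>
     (\<forall>y. (F has_real_derivative F1 y) (at y) \<and> (F1 has_real_derivative F2 y) (at y) \<and>
          (F2 has_real_derivative F3 y) (at y) \<and>
          \<bar>F y\<bar> \<le> K \<and> \<bar>F1 y\<bar> \<le> K \<and> \<bar>F2 y\<bar> \<le> K \<and> \<bar>F3 y\<bar> \<le> K)"

text \<open>Three successive moving averages \<open>G\<close>, \<open>H\<close>, \<open>F\<close>,
  one for each derivative. As the difference quotient \<open>D\<close> commutes with
  differentiation, the derivatives of \<open>F\<close> are \<open>D H\<close>,
  \<open>D (D G)\<close> and \<open>D (D (D h))\<close>; each \<open>D\<close> multiplies a bound by
  \<open>2 / \<delta>\<close>.\<close>

lemma C3_approximation:
  fixes h :: "real \<Rightarrow> real"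
  assumes h: "uniformly_continuous_on UNIV h" and B: "\<And>y. \<bar>h y\<bar> \<le> B" and "\<epsilon> > 0"
  obtains K F F1 F2 F3 where "C3_bounded_by K F F1 F2 F3" "\<And>y. \<bar>F y - h y\<bar> \<le> \<epsilon>"
proof -
  obtain d where "d > 0" and d: "\<And>x y. \<bar>x - y\<bar> < d \<Longrightarrow> \<bar>h x - h y\<bar> < \<epsilon>"
    using h \<open>\<epsilon> > 0\<close> unfolding uniformly_continuous_on_def dist_real_def by (metis UNIV_I)
  \<comment> \<open>Three averages look up to \<open>3 * \<delta>\<close> to the right, which has to
    stay strictly below \<open>d\<close>.\<close>
  define \<delta> where "\<delta> = d / 4"
  have \<delta>: "\<delta> > 0" "3 * \<delta> < d" using \<open>d > 0\<close> by (auto simp: \<delta>_def)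
  define D where "D f y = (f (y + \<delta>) - f y) / \<delta>" for f :: "real \<Rightarrow> real" and y
  have D_le: "\<bar>D f y\<bar> \<le> 2 * C / \<delta>" if "\<And>y. \<bar>f y\<bar> \<le> C" for f C y
    using abs_diff_quotient_le[OF that \<delta>(1)] by (simp add: D_def)
  have D_deriv: "(D f has_real_derivative D f' y) (at y)"
    if "\<And>y. (f has_real_derivative f' y) (at y)" for f f' y
    unfolding D_def using DERIV_diff_quotient[OF that \<delta>(1)] by simp
  have cont: "continuous_on UNIV f" if "\<And>y. (f has_real_derivative f' y) (at y)" for f f'
    using that by (meson DERIV_continuous_on has_field_derivative_at_within)
  obtain G where G: "\<And>y. (G has_real_derivative D h y) (at y)"
      "\<And>y. \<exists>\<xi>\<in>{y..y + \<delta>}. G y = h \<xi>"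
    using ex_moving_average[OF uniformly_continuous_imp_continuous[OF h] \<delta>(1)]
    unfolding D_def by metis
  obtain H where H: "\<And>y. (H has_real_derivative D G y) (at y)"
      "\<And>y. \<exists>\<xi>\<in>{y..y + \<delta>}. H y = G \<xi>"
    using ex_moving_average[OF cont[OF G(1)] \<delta>(1)] unfolding D_def by metis
  obtain F where F: "\<And>y. (F has_real_derivative D H y) (at y)"
      "\<And>y. \<exists>\<xi>\<in>{y..y + \<delta>}. F y = H \<xi>"
    using ex_moving_average[OF cont[OF H(1)] \<delta>(1)] unfolding D_def by metis
  have F_h: "\<exists>\<xi>\<in>{y..y + 3 * \<delta>}. F y = h \<xi>" for y
  proof -
    obtain a where a: "a \<in> {y..y + \<delta>}" "F y = H a" using F(2) by blast
    obtain b where b: "b \<in> {a..a + \<delta>}" "H a = G b" using H(2) by blast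
    obtain c where c: "c \<in> {b..b + \<delta>}" "G b = h c" using G(2) by blast
    from a b c show ?thesis by (intro bexI[of _ c]) auto
  qed
  define K where "K = Max {B, 2 * B / \<delta>, 2 * (2 * B / \<delta>) / \<delta>, 2 * (2 * (2 * B / \<delta>) / \<delta>) / \<delta>}"
  have K: "B \<le> K" "2 * B / \<delta> \<le> K" "2 * (2 * B / \<delta>) / \<delta> \<le> K"
      "2 * (2 * (2 * B / \<delta>) / \<delta>) / \<delta> \<le> K"
    unfolding K_def by (rule Max_ge; simp)+
  have GB: "\<bar>G y\<bar> \<le> B" for y using G(2)[of y] B by force
  have HB: "\<bar>H y\<bar> \<le> B" for y using H(2)[of y] GB by force
  have FB: "\<bar>F y\<bar> \<le> B" for y using F(2)[of y] HB by force
  have "C3_bounded_by K F (D H) (D (D G)) (D (D (D h)))"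
    unfolding C3_bounded_by_def
    using F(1) D_deriv[of H, OF H(1)] D_deriv[of "D G", OF D_deriv[of G, OF G(1)]]
      FB[THEN order_trans, OF K(1)] D_le[of H, OF HB, THEN order_trans, OF K(2)]
      D_le[of "D G", OF D_le[of G, OF GB], THEN order_trans, OF K(3)]
      D_le[of "D (D h)", OF D_le[of "D h", OF D_le[of h, OF B]], THEN order_trans, OF K(4)]
    by blast
  moreover have "\<bar>F y - h y\<bar> \<le> \<epsilon>" for y
  proof -
    obtain \<xi> where "\<xi> \<in> {y..y + 3 * \<delta>}" "F y = h \<xi>" using F_h by blast
    with d[of \<xi> y] \<delta> show ?thesis by auto
  qed
  ultimately show thesis by (rule that)
qed

section \<open>Taylor and Lipschitz estimates for the smooth functions\<close>

lemma C3_taylor: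
  assumes "C3_bounded_by K F F1 F2 F3"
  shows "\<bar>F (y + a) - (F y + F1 y * a + F2 y * a\<^sup>2 / 2)\<bar> \<le> K * \<bar>a\<bar> ^ 3"
proof -
  \<comment> \<open>The Maclaurin formula expects a single family of derivatives indexed by their
    order and expanded at 0, hence the case distinction and the shift by \<open>y\<close>.\<close>
  let ?diff = "\<lambda>m x. (if m = (0::nat) then F else if m = 1 then F1 else if m = 2 then F2 else F3) (y + x)"
  have "\<forall>m t. m < 3 \<and> \<bar>t\<bar> \<le> \<bar>a\<bar> \<longrightarrow> DERIV (?diff m) t :> ?diff (Suc m) t"
  proof (intro allI impI, elim conjE)
    fix m :: nat and t :: real assume "m < 3"
    then have "m = 0 \<or> m = 1 \<or> m = 2" by auto
    then show "DERIV (?diff m) t :> ?diff (Suc m) t"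
      using assms unfolding C3_bounded_by_def
      by (auto simp: DERIV_shift[of _ _ t y, symmetric] add.commute)
  qed
  from Maclaurin_bi_le[OF refl this] obtain t where
    "F (y + a) = (\<Sum>m<3. ?diff m 0 / fact m * a ^ m) + F3 (y + t) / fact 3 * a ^ 3"
    by auto
  then have eq: "F (y + a) - (F y + F1 y * a + F2 y * a\<^sup>2 / 2) = F3 (y + t) / 6 * a ^ 3"
    by (simp add: eval_nat_numeral)
  have F3: "\<bar>F3 (y + t)\<bar> \<le> K"
    using assms unfolding C3_bounded_by_def by blast
  have "\<bar>F (y + a) - (F y + F1 y * a + F2 y * a\<^sup>2 / 2)\<bar> = \<bar>F3 (y + t)\<bar> / 6 * \<bar>a\<bar> ^ 3"
    unfolding eq by (simp add: abs_mult power_abs)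
  also have "\<dots> \<le> K * \<bar>a\<bar> ^ 3"
    using F3 by (intro mult_right_mono) auto
  finally show ?thesis .
qed

lemma C3_borel_measurable:
  assumes "C3_bounded_by K F F1 F2 F3"
  shows "F \<in> borel_measurable borel"
proof -
  have "continuous_on UNIV F"
    using assms unfolding C3_bounded_by_def
    by (meson DERIV_continuous_on has_field_derivative_at_within)
  then show ?thesis by (rule borel_measurable_continuous_onI)
qed

lemma C3_lipschitz:
  assumes "C3_bounded_by K F F1 F2 F3"
  shows "\<bar>F a - F b\<bar> \<le> K * \<bar>a - b\<bar>"
proof -
  have "norm (F a - F b) \<le> K * norm (a - b)"
    by (rule field_differentiable_bound[of UNIV F F1])
      (use assms in \<open>auto simp: C3_bounded_by_def\<close>)
  then show ?thesis by simp
qed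

text \<open>The gap between the two sides is \<open>3 * (a + b) * (a - b)\<^sup>2\<close>. This
  separates the drift from the Gaussian part in the cubic remainder of
  \<open>heat_expansion\<close>.\<close>

lemma cube_add_le:
  fixes a b :: real
  assumes "0 \<le> a" "0 \<le> b"
  shows "(a + b) ^ 3 \<le> 4 * (a ^ 3 + b ^ 3)"
proof -
  have "4 * (a ^ 3 + b ^ 3) - (a + b) ^ 3 = 3 * (a + b) * (a - b)\<^sup>2"
    by (simp add: power2_eq_square power3_eq_cube algebra_simps)
  moreover have "\<dots> \<ge> 0" using assms by simp
  ultimately show ?thesis by linarith
qed

section \<open>Payoffs in \<open>Cc_nonneg\<close>\<close>

lemma Cc_nonneg_vanishes:
  assumes "g \<in> Cc_nonneg"
  obtains R where "R > 0" "\<And>x. x \<ge> R \<Longrightarrow> g x = 0"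
proof -
  have "bounded {x \<in> {0..}. g x \<noteq> 0}"
    using assms unfolding Cc_nonneg_def
    by (auto dest!: compact_imp_bounded intro: bounded_subset closure_subset)
  then obtain R where R: "\<And>x. x \<ge> 0 \<Longrightarrow> g x \<noteq> 0 \<Longrightarrow> \<bar>x\<bar> \<le> R"
    unfolding bounded_real by auto
  \<comment> \<open>\<open>R + 1\<close> lies strictly beyond the support, and the maximum with 1
    keeps the threshold positive whatever \<open>R\<close> is, so that its logarithm can be taken
    later.\<close>
  show thesis
    by (rule that[of "max 1 (R + 1)"]) (use R in \<open>auto, smt (verit)\<close>)
qed

lemma Cc_nonneg_bounded:
  assumes "g \<in> Cc_nonneg"
  obtains B where "\<And>x. x \<ge> 0 \<Longrightarrow> \<bar>g x\<bar> \<le> B"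
proof -
  obtain R where R: "\<And>x. x \<ge> R \<Longrightarrow> g x = 0"
    using Cc_nonneg_vanishes[OF assms] by blast
  have "continuous_on {0..R} g"
    using assms unfolding Cc_nonneg_def by (auto intro: continuous_on_subset)
  then have "compact (g ` {0..R})"
    by (rule compact_continuous_image) simp
  then obtain B where B: "\<forall>x\<in>{0..R}. \<bar>g x\<bar> \<le> B"
    by (auto dest!: compact_imp_bounded simp: bounded_real)
  show thesis
  proof
    fix x :: real assume "x \<ge> 0"
    then show "\<bar>g x\<bar> \<le> max B 0"
      using B R[of x] by (cases "x \<le> R") (force simp: le_max_iff_disj)+
  qed
qed

text \<open>Nothing goes wrong as \<open>y\<close> tends to minus infinity: \<open>exp\<close> is
  Lipschitz on each left half-line and maps it into a compact interval, where \<open>g\<close> is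
  uniformly continuous. Far to the right \<open>g\<close> vanishes.\<close>

lemma Cc_nonneg_uniformly_continuous_exp:
  assumes "g \<in> Cc_nonneg"
  shows "uniformly_continuous_on UNIV (\<lambda>y. g (exp y))"
proof -
  obtain R where R: "R > 0" "\<And>x. x \<ge> R \<Longrightarrow> g x = 0"
    using Cc_nonneg_vanishes[OF assms] by blast
  \<comment> \<open>The margin 1 matches the \<open>min 1\<close> below: two points at distance less
    than 1 both lie below \<open>L\<close>, or both lie above \<open>ln R\<close>, where
    \<open>g\<close> composed with \<open>exp\<close> is 0.\<close>
  define L where "L = ln R + 1"
  have "continuous_on {0..exp L} g"
    using assms unfolding Cc_nonneg_def by (auto intro: continuous_on_subset)
  then have g: "uniformly_continuous_on {0..exp L} g"
    by (rule compact_uniformly_continuous) simp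
  show ?thesis
    unfolding uniformly_continuous_on_def
  proof (intro allI impI)
    fix \<epsilon> :: real assume "\<epsilon> > 0"
    then obtain d where d: "d > 0"
      "\<And>x x'. x \<in> {0..exp L} \<Longrightarrow> x' \<in> {0..exp L} \<Longrightarrow> \<bar>x' - x\<bar> < d \<Longrightarrow> \<bar>g x' - g x\<bar> < \<epsilon>"
      using g unfolding uniformly_continuous_on_def dist_real_def by metis
    have exp_lip: "\<bar>exp y' - exp y\<bar> \<le> exp L * \<bar>y' - y\<bar>" if "y \<le> L" "y' \<le> L" for y y'
    proof -
      have "norm (exp y' - exp y) \<le> exp L * norm (y' - y)"
        by (rule field_differentiable_bound[of "{..L}" exp exp])
          (use that in \<open>auto intro: DERIV_subset[OF DERIV_exp]\<close>)
      then show ?thesis by simp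
    qed
    have "\<bar>g (exp y') - g (exp y)\<bar> < \<epsilon>" if "\<bar>y' - y\<bar> < min 1 (d / exp L)" for y y'
    proof (cases "y \<le> L \<and> y' \<le> L")
      case True
      then have "\<bar>exp y' - exp y\<bar> \<le> exp L * \<bar>y' - y\<bar>" using exp_lip by blast
      also have "\<dots> < d" using that by (simp add: field_simps)
      finally show ?thesis using True by (intro d(2)) auto
    next
      case False
      with that have "ln R \<le> y" "ln R \<le> y'" by (auto simp: L_def)
      then have "R \<le> exp y" "R \<le> exp y'" using \<open>R > 0\<close> by (auto simp: ln_ge_iff ln_le_cancel_iff[symmetric] simp del: ln_le_cancel_iff)
      with R \<open>\<epsilon> > 0\<close> show ?thesis by auto
    qed
    with d(1) show "\<exists>d>0. \<forall>x\<in>UNIV. \<forall>x'\<in>UNIV. dist x' x < d \<longrightarrow> dist (g (exp x')) (g (exp x)) < \<epsilon>"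
      by (intro exI[of _ "min 1 (d / exp L)"]) (auto simp: dist_real_def)
  qed
qed

text \<open>\<open>g\<close> is controlled only on the half-line. Composition with
  \<open>max 0\<close> keeps its values there and makes it continuous on all reals, which gives
  Borel measurability and a global bound.\<close>

lemma continuous_on_Cc_nonneg_max:
  assumes "g \<in> Cc_nonneg"
  shows "continuous_on UNIV (\<lambda>x. g (max 0 x))"
proof (rule continuous_on_compose2[of "{0..}" g])
  show "continuous_on {0..} g" using assms by (simp add: Cc_nonneg_def)
qed (auto intro!: continuous_intros)

lemma borel_measurable_Cc_nonneg_max:
  "g \<in> Cc_nonneg \<Longrightarrow> (\<lambda>x. g (max 0 x)) \<in> borel_measurable borel"
  by (intro borel_measurable_continuous_onI continuous_on_Cc_nonneg_max)

subsection \<open>The binomial model\<close>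

text \<open>The transition operator of the chain. It contains no discount; that stays outside as a
  power of \<open>rate_factor\<close>.\<close>

definition binomial_step :: "real \<Rightarrow> real \<Rightarrow> real \<Rightarrow> (real \<Rightarrow> real) \<Rightarrow> real \<Rightarrow> real" where
  "binomial_step p u d \<phi> x = p * \<phi> (x * u) + (1 - p) * \<phi> (x * d)"

text \<open>Pascal's rule against arbitrary weights: \<open>c i j\<close> stands for
  \<open>i\<close> up-moves and \<open>j\<close> down-moves, so that probabilities and payoff values
  are treated together.\<close>

lemma binomial_sum_Suc:
  fixes c :: "nat \<Rightarrow> nat \<Rightarrow> real"
  shows "(\<Sum>i\<le>n. real (n choose i) * c (Suc i) (n - i)) + (\<Sum>i\<le>n. real (n choose i) * c i (Suc n - i))
    = (\<Sum>i\<le>Suc n. real (Suc n choose i) * c i (Suc n - i))"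
proof -
  \<comment> \<open>The additional summand has the coefficient \<open>n choose Suc n\<close>, which
    is 0.\<close>
  have "(\<Sum>i\<le>n. real (n choose i) * c i (Suc n - i)) = (\<Sum>i\<le>Suc n. real (n choose i) * c i (Suc n - i))"
    by simp
  also have "\<dots> = c 0 (Suc n) + (\<Sum>i\<le>n. real (n choose Suc i) * c (Suc i) (n - i))"
    by (subst sum.atMost_Suc_shift) simp
  finally have eq: "(\<Sum>i\<le>n. real (n choose i) * c i (Suc n - i)) = \<dots>" .
  have "(\<Sum>i\<le>Suc n. real (Suc n choose i) * c i (Suc n - i)) =
      c 0 (Suc n) + (\<Sum>i\<le>n. real (Suc n choose Suc i) * c (Suc i) (n - i))"
    by (subst sum.atMost_Suc_shift) simp
  then show ?thesis
    unfolding eq by (simp add: sum.distrib algebra_simps)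
qed

lemma binomial_step_funpow:
  "(binomial_step p u d ^^ n) \<phi> x =
    (\<Sum>i=0..n. real (n choose i) * p ^ i * (1 - p) ^ (n - i) * \<phi> (x * u ^ i * d ^ (n - i)))"
proof (induction n arbitrary: x)
  case 0
  show ?case by simp
next
  case (Suc n)
  let ?c = "\<lambda>i j. p ^ i * (1 - p) ^ j * \<phi> (x * u ^ i * d ^ j)"
  have "(binomial_step p u d ^^ Suc n) \<phi> x =
      (\<Sum>i\<le>n. real (n choose i) * ?c (Suc i) (n - i)) + (\<Sum>i\<le>n. real (n choose i) * ?c i (Suc n - i))"
    by (simp add: binomial_step_def Suc sum_distrib_left atLeast0AtMost Suc_diff_le ac_simps)
  also have "\<dots> = (\<Sum>i\<le>Suc n. real (Suc n choose i) * ?c i (Suc n - i))"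
    by (rule binomial_sum_Suc)
  finally show ?case by (simp only: atLeast0AtMost mult.assoc)
qed

lemma q_minus_eq: "q_minus \<mu> \<sigma> r m = 1 - q_plus \<mu> \<sigma> r m"
  by (simp add: q_minus_def q_plus_def)

lemma discrete_price_eq_funpow:
  "discrete_price \<mu> \<sigma> r T g m k x =
    rate_factor r m powi (int k - int (grid_index m T)) *
    (binomial_step (q_plus \<mu> \<sigma> r m) (up_factor \<mu> \<sigma> m) (down_factor \<mu> \<sigma> m)
      ^^ (grid_index m T - k)) g x"
  by (simp add: discrete_price_def binomial_step_funpow q_minus_eq Let_def)

lemma down_less_up: "\<sigma> > 0 \<Longrightarrow> down_factor \<mu> \<sigma> m < up_factor \<mu> \<sigma> m"
  by (simp add: up_factor_def down_factor_def)

section \<open>Conditional expectations in the binomial model\<close>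

lemma (in prob_space) integral_uniform_measure:
  fixes f :: "'a \<Rightarrow> real"
  assumes [measurable]: "A \<in> sets M" "f \<in> borel_measurable M" and "prob A > 0"
  shows "(\<integral>\<omega>. f \<omega> \<partial>uniform_measure M A) = (\<integral>\<omega>. indicator A \<omega> * f \<omega> \<partial>M) / prob A"
proof -
  have "uniform_measure M A = density M (\<lambda>\<omega>. ennreal (indicator A \<omega> / prob A))"
    unfolding uniform_measure_def
    using assms(3) by (intro density_cong)
      (auto simp: emeasure_eq_measure divide_ennreal[symmetric] ennreal_indicator)
  then have "(\<integral>\<omega>. f \<omega> \<partial>uniform_measure M A) = (\<integral>\<omega>. (indicator A \<omega> / prob A) * f \<omega> \<partial>M)"
    by (simp add: integral_density)
  also have "\<dots> = (\<integral>\<omega>. indicator A \<omega> * f \<omega> / prob A \<partial>M)"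
    by simp
  finally show ?thesis by simp
qed

lemma borel_measurable_binomial_step [measurable]:
  assumes [measurable]: "\<phi> \<in> borel_measurable borel"
  shows "binomial_step p u d \<phi> \<in> borel_measurable borel"
  unfolding binomial_step_def by measurable

lemma abs_binomial_step_le:
  assumes "0 \<le> p" "p \<le> 1" "\<And>x. \<bar>\<phi> x\<bar> \<le> B"
  shows "\<bar>binomial_step p u d \<phi> x\<bar> \<le> B"
proof -
  have "\<bar>binomial_step p u d \<phi> x\<bar> \<le> \<bar>p * \<phi> (x * u)\<bar> + \<bar>(1 - p) * \<phi> (x * d)\<bar>"
    unfolding binomial_step_def by (rule abs_triangle_ineq)
  also have "\<dots> \<le> p * B + (1 - p) * B"
    using assms by (auto simp: abs_mult intro!: add_mono mult_left_mono)
  finally show ?thesis by (simp add: algebra_simps)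
qed

text \<open>Averages out the next ratio \<open>\<rho> (V \<omega>)\<close> given the past
  \<open>Z \<omega>\<close>: split according to the two values of the ratio, then factor each
  expectation by independence. \<open>\<psi>\<close> will be the indicator of the conditioning
  event.\<close>

lemma (in prob_space) expectation_two_valued_indep:
  fixes Z V and \<rho> Y \<phi> \<psi> :: "_ \<Rightarrow> real"
  assumes [measurable]: "\<rho> \<in> borel_measurable L" "\<phi> \<in> borel_measurable borel"
    and indep: "indep_var N Z L V"
    and [measurable]: "\<psi> \<in> borel_measurable N" "Y \<in> borel_measurable N"
    and \<psi>: "\<And>z. \<bar>\<psi> z\<bar> \<le> 1" and \<phi>: "\<And>x. \<bar>\<phi> x\<bar> \<le> B"
    and "u \<noteq> d"
    and pu: "prob {\<omega> \<in> space M. \<rho> (V \<omega>) = u} = p" and pd: "prob {\<omega> \<in> space M. \<rho> (V \<omega>) = d} = 1 - p"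
  shows "expectation (\<lambda>\<omega>. \<psi> (Z \<omega>) * \<phi> (Y (Z \<omega>) * \<rho> (V \<omega>))) =
    expectation (\<lambda>\<omega>. \<psi> (Z \<omega>) * binomial_step p u d \<phi> (Y (Z \<omega>)))"
proof -
  have [measurable]: "Z \<in> measurable M N"
    using indep by (rule indep_var_rv1)
  have [measurable]: "V \<in> measurable M L"
    using indep by (rule indep_var_rv2)
  let ?U = "{\<omega> \<in> space M. \<rho> (V \<omega>) = u}" and ?D = "{\<omega> \<in> space M. \<rho> (V \<omega>) = d}"
  \<comment> \<open>The masses \<open>p\<close> and \<open>1 - p\<close> leave no room for a third
    value, so the ratio is almost surely \<open>u\<close> or \<open>d\<close>.\<close>
  have "prob (?U \<union> ?D) = 1"
    using \<open>u \<noteq> d\<close> pu pd by (subst finite_measure_Union) auto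
  then have "AE \<omega> in M. \<omega> \<in> ?U \<union> ?D"
    by (subst prob_eq_1[symmetric]) auto
  then have R: "AE \<omega> in M. \<rho> (V \<omega>) = u \<or> \<rho> (V \<omega>) = d"
    by eventually_elim auto
  have bnd: "\<bar>\<psi> z * \<phi> x\<bar> \<le> B" for z x
    using mult_mono[OF \<psi>[of z] \<phi>[of x]] by (simp add: abs_mult)
  have int: "integrable M (\<lambda>\<omega>. \<psi> (Z \<omega>) * \<phi> (Y (Z \<omega>) * c))" for c
    by (rule integrable_const_bound[of _ B]) (use bnd in auto)
  have indR: "integrable M (\<lambda>\<omega>. indicator {c} (\<rho> (V \<omega>)) :: real)" for c
    by (rule integrable_const_bound[of _ 1]) (auto simp: indicator_def)
  have prod_ind: "indep_var borel (\<lambda>\<omega>. \<psi> (Z \<omega>) * \<phi> (Y (Z \<omega>) * c)) borel (\<lambda>\<omega>. indicator {c} (\<rho> (V \<omega>)) :: real)" for c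
    using indep_var_compose[OF indep, of "\<lambda>z. \<psi> z * \<phi> (Y z * c)" borel "\<lambda>v. indicator {c} (\<rho> v)" borel]
    by (simp add: comp_def)
  have prob_ind: "expectation (\<lambda>\<omega>. indicator {c} (\<rho> (V \<omega>)) :: real) = prob {\<omega> \<in> space M. \<rho> (V \<omega>) = c}" for c
  proof -
    have "expectation (\<lambda>\<omega>. indicator {c} (\<rho> (V \<omega>)) :: real) =
        expectation (indicator {\<omega> \<in> space M. \<rho> (V \<omega>) = c})"
      by (intro Bochner_Integration.integral_cong) (auto simp: indicator_def)
    then show ?thesis by simp
  qed
  have "expectation (\<lambda>\<omega>. \<psi> (Z \<omega>) * \<phi> (Y (Z \<omega>) * \<rho> (V \<omega>))) =
      expectation (\<lambda>\<omega>. \<psi> (Z \<omega>) * \<phi> (Y (Z \<omega>) * u) * indicator {u} (\<rho> (V \<omega>))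
        + \<psi> (Z \<omega>) * \<phi> (Y (Z \<omega>) * d) * indicator {d} (\<rho> (V \<omega>)))"
  proof (rule integral_cong_AE)
    show "AE \<omega> in M. \<psi> (Z \<omega>) * \<phi> (Y (Z \<omega>) * \<rho> (V \<omega>)) =
        \<psi> (Z \<omega>) * \<phi> (Y (Z \<omega>) * u) * indicator {u} (\<rho> (V \<omega>))
        + \<psi> (Z \<omega>) * \<phi> (Y (Z \<omega>) * d) * indicator {d} (\<rho> (V \<omega>))"
      using R by eventually_elim (use \<open>u \<noteq> d\<close> in auto)
  qed measurable
  also have "\<dots> = expectation (\<lambda>\<omega>. \<psi> (Z \<omega>) * \<phi> (Y (Z \<omega>) * u)) * p
      + expectation (\<lambda>\<omega>. \<psi> (Z \<omega>) * \<phi> (Y (Z \<omega>) * d)) * (1 - p)"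
    using indep_var_lebesgue_integral[OF prod_ind int indR]
      indep_var_integrable[OF prod_ind int indR] pu pd
    by (simp add: prob_ind)
  also have "\<dots> = expectation (\<lambda>\<omega>. p * (\<psi> (Z \<omega>) * \<phi> (Y (Z \<omega>) * u))
      + (1 - p) * (\<psi> (Z \<omega>) * \<phi> (Y (Z \<omega>) * d)))"
    using int by simp
  also have "\<dots> = expectation (\<lambda>\<omega>. \<psi> (Z \<omega>) * binomial_step p u d \<phi> (Y (Z \<omega>)))"
    by (intro Bochner_Integration.integral_cong) (auto simp: binomial_step_def algebra_simps)
  finally show ?thesis .
qed

text \<open>Since \<open>k \<le> j\<close>, both \<open>S k\<close> and \<open>S j\<close> are
  functions of the ratios with index below \<open>j\<close>, which are jointly independent of ratio
  \<open>j\<close>.\<close>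

lemma discrete_stock_transition:
  assumes S: "discrete_stock \<mu> \<sigma> r T m s Q S" and "\<sigma> > 0"
    and [measurable]: "\<phi> \<in> borel_measurable borel" and \<phi>: "\<And>x. \<bar>\<phi> x\<bar> \<le> B"
    and j: "j < grid_index m T" "k \<le> j"
  shows "(\<integral>\<omega>. indicator {x} (S k \<omega>) * \<phi> (S (Suc j) \<omega>) \<partial>Q) =
    (\<integral>\<omega>. indicator {x} (S k \<omega>) *
      binomial_step (q_plus \<mu> \<sigma> r m) (up_factor \<mu> \<sigma> m) (down_factor \<mu> \<sigma> m) \<phi> (S j \<omega>) \<partial>Q)"
proof -
  let ?N = "grid_index m T"
  interpret prob_space Q using S by (simp add: discrete_stock_def)
  have S_meas: "S i \<in> borel_measurable Q" and S_pos: "\<And>\<omega>. \<omega> \<in> space Q \<Longrightarrow> S i \<omega> > 0"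
    if "i \<le> ?N" for i
    using S that by (auto simp: discrete_stock_def)
  have [measurable]: "S j \<in> borel_measurable Q" "S (Suc j) \<in> borel_measurable Q"
    using S_meas j by auto
  define R where "R i \<omega> = S (Suc i) \<omega> / S i \<omega>" for i \<omega>
  have R: "indep_vars (\<lambda>_. borel) R {..<?N}"
    using S unfolding discrete_stock_def R_def by simp
  \<comment> \<open>The start \<open>s\<close> is constant, so the ratios alone determine the
    path.\<close>
  have S_prod: "S i \<omega> = s * (\<Prod>l<i. R l \<omega>)" if "\<omega> \<in> space Q" "i \<le> ?N" for i \<omega>
    using that(2)
  proof (induction i)
    case 0
    show ?case using S that(1) by (simp add: discrete_stock_def)
  next
    case (Suc i)
    have "S i \<omega> \<noteq> 0" using S_pos[of i \<omega>] Suc.prems that(1) by simp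
    then have "S (Suc i) \<omega> = S i \<omega> * R i \<omega>" by (simp add: R_def)
    also have "S i \<omega> = s * (\<Prod>l<i. R l \<omega>)" using Suc by simp
    finally show ?case by simp
  qed
  \<comment> \<open>Past and next ratio are both taken as restricted families, the form in which
    \<open>indep_vars\<close> yields joint independence over disjoint index sets.\<close>
  define Z where "Z \<omega> = restrict (\<lambda>i. R i \<omega>) {..<j}" for \<omega>
  define V where "V \<omega> = restrict (\<lambda>i. R i \<omega>) {j}" for \<omega>
  have indep: "indep_var (PiM {..<j} (\<lambda>_. borel)) Z (PiM {j} (\<lambda>_. borel)) V"
    unfolding Z_def V_def using j by (intro indep_var_restrict[OF R]) auto
  have V: "V \<omega> j = R j \<omega>" for \<omega> by (simp add: V_def)
  define Y where "Y i v = s * (\<Prod>l<i. v l)" for i and v :: "nat \<Rightarrow> real"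
  have Y_meas: "Y i \<in> borel_measurable (PiM {..<j} (\<lambda>_. borel))" if "i \<le> j" for i
    unfolding Y_def using that
    by (intro borel_measurable_times borel_measurable_prod borel_measurable_const
      measurable_component_singleton) auto
  have [measurable]: "Y j \<in> borel_measurable (PiM {..<j} (\<lambda>_. borel))"
    "Y k \<in> borel_measurable (PiM {..<j} (\<lambda>_. borel))"
    using Y_meas j by auto
  have Y: "S i \<omega> = Y i (Z \<omega>)" if "\<omega> \<in> space Q" "i \<le> j" for i \<omega>
  proof -
    have "(\<Prod>l<i. Z \<omega> l) = (\<Prod>l<i. R l \<omega>)"
      unfolding Z_def using that(2) by (intro prod.cong) auto
    with S_prod[OF that(1), of i] that(2) j show ?thesis by (simp add: Y_def)
  qed
  have S_Suc: "S (Suc j) \<omega> = Y j (Z \<omega>) * V \<omega> j" if "\<omega> \<in> space Q" for \<omega>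
  proof -
    have "S (Suc j) \<omega> = S j \<omega> * R j \<omega>"
      using S_pos[of j \<omega>] j that by (simp add: R_def)
    then show ?thesis using Y[OF that order_refl] by (simp add: V)
  qed
  let ?A = "binomial_step (q_plus \<mu> \<sigma> r m) (up_factor \<mu> \<sigma> m) (down_factor \<mu> \<sigma> m)"
  have "(\<integral>\<omega>. indicator {x} (S k \<omega>) * \<phi> (S (Suc j) \<omega>) \<partial>Q) =
      expectation (\<lambda>\<omega>. indicator {x} (Y k (Z \<omega>)) * \<phi> (Y j (Z \<omega>) * V \<omega> j))"
    using j by (intro Bochner_Integration.integral_cong) (simp_all add: S_Suc Y)
  also have "\<dots> = expectation (\<lambda>\<omega>. indicator {x} (Y k (Z \<omega>)) * ?A \<phi> (Y j (Z \<omega>)))"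
  proof (rule expectation_two_valued_indep[where \<psi>="\<lambda>v. indicator {x} (Y k v)" and \<rho>="\<lambda>v. v j"])
    show "(\<lambda>v. v j) \<in> borel_measurable (PiM {j} (\<lambda>_. borel))"
      by (rule measurable_component_singleton) simp
    show "Y j \<in> borel_measurable (PiM {..<j} (\<lambda>_. borel))"
      "(\<lambda>v. indicator {x} (Y k v) :: real) \<in> borel_measurable (PiM {..<j} (\<lambda>_. borel))"
      by measurable
    show "up_factor \<mu> \<sigma> m \<noteq> down_factor \<mu> \<sigma> m"
      using down_less_up[OF \<open>\<sigma> > 0\<close>] by (metis less_irrefl)
    show "prob {\<omega> \<in> space Q. V \<omega> j = up_factor \<mu> \<sigma> m} = q_plus \<mu> \<sigma> r m"
      "prob {\<omega> \<in> space Q. V \<omega> j = down_factor \<mu> \<sigma> m} = 1 - q_plus \<mu> \<sigma> r m"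
      using S j(1) by (simp_all add: V R_def discrete_stock_def q_minus_eq)
  qed (use \<phi> indep in \<open>simp_all\<close>)
  also have "\<dots> = (\<integral>\<omega>. indicator {x} (S k \<omega>) * ?A \<phi> (S j \<omega>) \<partial>Q)"
    using j by (intro Bochner_Integration.integral_cong) (simp_all add: Y)
  finally show ?thesis .
qed

text \<open>The induction removes the latest step and replaces \<open>\<phi>\<close> by its one-step
  average, which is again measurable and bounded by \<open>B\<close>; this is why
  \<open>\<phi>\<close> is arbitrary in it.\<close>

lemma discrete_stock_markov:
  assumes S: "discrete_stock \<mu> \<sigma> r T m s Q S" and "\<sigma> > 0" and "admissible \<mu> \<sigma> r m"
    and \<phi>: "\<phi> \<in> borel_measurable borel" "\<And>x. \<bar>\<phi> x\<bar> \<le> B"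
    and "k + n \<le> grid_index m T"
  shows "(\<integral>\<omega>. indicator {x} (S k \<omega>) * \<phi> (S (k + n) \<omega>) \<partial>Q) =
    (\<integral>\<omega>. indicator {x} (S k \<omega>) *
      (binomial_step (q_plus \<mu> \<sigma> r m) (up_factor \<mu> \<sigma> m) (down_factor \<mu> \<sigma> m) ^^ n) \<phi> (S k \<omega>) \<partial>Q)"
  using assms(6) \<phi>
proof (induction n arbitrary: \<phi>)
  case 0
  show ?case by simp
next
  case (Suc n)
  let ?A = "binomial_step (q_plus \<mu> \<sigma> r m) (up_factor \<mu> \<sigma> m) (down_factor \<mu> \<sigma> m)"
  have "(\<integral>\<omega>. indicator {x} (S k \<omega>) * \<phi> (S (k + Suc n) \<omega>) \<partial>Q) =
      (\<integral>\<omega>. indicator {x} (S k \<omega>) * ?A \<phi> (S (k + n) \<omega>) \<partial>Q)"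
    using discrete_stock_transition[OF S \<open>\<sigma> > 0\<close> Suc.prems(2,3), of "k + n" k x] Suc.prems(1)
    by simp
  also have "\<dots> = (\<integral>\<omega>. indicator {x} (S k \<omega>) * (?A ^^ n) (?A \<phi>) (S k \<omega>) \<partial>Q)"
    using Suc.prems \<open>admissible \<mu> \<sigma> r m\<close>
    by (intro Suc.IH abs_binomial_step_le borel_measurable_binomial_step)
      (auto simp: admissible_def)
  finally show ?case by (simp add: funpow_swap1)
qed

text \<open>By the Markov property the integral over the conditioning event is its probability times
  the iterated operator at the fixed point \<open>x\<close>; that probability then cancels.\<close>

lemma discrete_price_eq_cond_expectation:
  assumes g: "g \<in> Cc_nonneg" and "\<sigma> > 0" and adm: "admissible \<mu> \<sigma> r m"
    and S: "discrete_stock \<mu> \<sigma> r T m s Q S"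
    and t: "t \<in> {0..T}" and "x > 0"
    and pos: "measure Q {\<omega> \<in> space Q. S (grid_index m t) \<omega> = x} > 0"
  shows "discrete_price \<mu> \<sigma> r T g m (grid_index m t) x =
    (\<integral>\<omega>. rate_factor r m powi (\<lfloor>t * 2 ^ (2 * m)\<rfloor> - \<lfloor>T * 2 ^ (2 * m)\<rfloor>) * g (S (grid_index m T) \<omega>)
      \<partial>uniform_measure Q {\<omega> \<in> space Q. S (grid_index m t) \<omega> = x})"
proof -
  interpret prob_space Q using S by (simp add: discrete_stock_def)
  let ?k = "grid_index m t" and ?N = "grid_index m T"
  let ?A = "binomial_step (q_plus \<mu> \<sigma> r m) (up_factor \<mu> \<sigma> m) (down_factor \<mu> \<sigma> m)"
  let ?C = "{\<omega> \<in> space Q. S ?k \<omega> = x}"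
  define \<phi> where "\<phi> x = g (max 0 x)" for x
  have "t * 2 ^ (2 * m) \<le> T * 2 ^ (2 * m)" using t by auto
  then have k: "?k \<le> ?N" unfolding grid_index_def by (intro nat_mono floor_mono)
  have floor: "\<lfloor>t * 2 ^ (2 * m)\<rfloor> = int ?k" "\<lfloor>T * 2 ^ (2 * m)\<rfloor> = int ?N"
    using t by (simp_all add: grid_index_def)
  obtain B where B: "\<And>x. x \<ge> 0 \<Longrightarrow> \<bar>g x\<bar> \<le> B"
    using Cc_nonneg_bounded[OF g] by blast
  have \<phi>: "\<phi> \<in> borel_measurable borel" "\<And>x. \<bar>\<phi> x\<bar> \<le> B"
    unfolding \<phi>_def using borel_measurable_Cc_nonneg_max[OF g] B by auto
  have S_meas: "S i \<in> borel_measurable Q" and S_pos: "\<And>\<omega>. \<omega> \<in> space Q \<Longrightarrow> S i \<omega> > 0"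
    if "i \<le> ?N" for i
    using S that by (auto simp: discrete_stock_def)
  have [measurable]: "S ?k \<in> borel_measurable Q" "S ?N \<in> borel_measurable Q" "\<phi> \<in> borel_measurable borel"
    using S_meas k \<phi> by auto
  have pos_steps: "0 < down_factor \<mu> \<sigma> m" "0 < up_factor \<mu> \<sigma> m"
    using adm down_less_up[OF \<open>\<sigma> > 0\<close>, of \<mu> m] by (auto simp: admissible_def)
  \<comment> \<open>Starting from a positive price only positive prices are reached, so the
    truncation in \<open>\<phi>\<close> is invisible.\<close>
  have A_eq: "(?A ^^ n) \<phi> y = (?A ^^ n) g y" if "y > 0" for n y
    using that pos_steps unfolding binomial_step_funpow \<phi>_def
    by (intro sum.cong refl) (simp add: max_def zero_le_mult_iff less_imp_le)
  let ?\<rho> = "rate_factor r m powi (int ?k - int ?N)"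
  have "(\<integral>\<omega>. ?\<rho> * g (S ?N \<omega>) \<partial>uniform_measure Q ?C) = (\<integral>\<omega>. ?\<rho> * \<phi> (S ?N \<omega>) \<partial>uniform_measure Q ?C)"
  proof (intro Bochner_Integration.integral_cong refl)
    fix \<omega> assume "\<omega> \<in> space (uniform_measure Q ?C)"
    then have "S ?N \<omega> > 0" using S_pos[of ?N] by simp
    then show "?\<rho> * g (S ?N \<omega>) = ?\<rho> * \<phi> (S ?N \<omega>)" by (simp add: \<phi>_def max_def)
  qed
  also have "\<dots> = (\<integral>\<omega>. ?\<rho> * (indicator ?C \<omega> * \<phi> (S ?N \<omega>)) \<partial>Q) / prob ?C"
    using pos by (subst integral_uniform_measure) (auto simp: ac_simps)
  also have "(\<integral>\<omega>. ?\<rho> * (indicator ?C \<omega> * \<phi> (S ?N \<omega>)) \<partial>Q) = ?\<rho> * (\<integral>\<omega>. indicator ?C \<omega> * \<phi> (S ?N \<omega>) \<partial>Q)"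
    by simp
  also have "(\<integral>\<omega>. indicator ?C \<omega> * \<phi> (S ?N \<omega>) \<partial>Q) = (\<integral>\<omega>. indicator {x} (S ?k \<omega>) * \<phi> (S (?k + (?N - ?k)) \<omega>) \<partial>Q)"
    using k by (intro Bochner_Integration.integral_cong) (auto simp: indicator_def)
  also have "\<dots> = (\<integral>\<omega>. indicator {x} (S ?k \<omega>) * (?A ^^ (?N - ?k)) \<phi> (S ?k \<omega>) \<partial>Q)"
    using k by (intro discrete_stock_markov[OF S \<open>\<sigma> > 0\<close> adm \<phi>]) simp
  also have "\<dots> = (\<integral>\<omega>. indicator ?C \<omega> * (?A ^^ (?N - ?k)) g x \<partial>Q)"
    using A_eq[OF \<open>x > 0\<close>] by (intro Bochner_Integration.integral_cong) (auto simp: indicator_def)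
  also have "\<dots> = prob ?C * (?A ^^ (?N - ?k)) g x"
    by simp
  finally have eq: "(\<integral>\<omega>. ?\<rho> * g (S ?N \<omega>) \<partial>uniform_measure Q ?C) =
      ?\<rho> * (prob ?C * (?A ^^ (?N - ?k)) g x) / prob ?C" .
  show ?thesis
    unfolding discrete_price_eq_funpow floor eq using pos by simp
qed

subsection \<open>Brownian motion and the Black--Scholes semigroup\<close>

lemma (in prob_space) indep_var_of_indep_vars:
  assumes "indep_vars N X I" "i \<in> I" "j \<in> I" "i \<noteq> j"
  shows "indep_var (N i) (X i) (N j) (X j)"
proof -
  have "indep_var (PiM {i} N) (\<lambda>\<omega>. restrict (\<lambda>i. X i \<omega>) {i}) (PiM {j} N) (\<lambda>\<omega>. restrict (\<lambda>i. X i \<omega>) {j})"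
    using assms by (intro indep_var_restrict) auto
  from indep_var_compose[OF this measurable_component_singleton[of i] measurable_component_singleton[of j]]
  show ?thesis by (simp add: comp_def)
qed

locale brownian =
  fixes M :: "'a measure" and W :: "real \<Rightarrow> 'a \<Rightarrow> real"
  assumes brownian: "brownian_motion M W"
begin

sublocale prob_space M
  using brownian by (simp add: brownian_motion_def)

lemma borel_measurable_W [measurable]: "0 \<le> t \<Longrightarrow> W t \<in> borel_measurable M"
  using brownian by (simp add: brownian_motion_def)

lemma AE_W_0: "AE \<omega> in M. W 0 \<omega> = 0"
  using brownian by (simp add: brownian_motion_def)

lemma distributed_increment:
  "0 \<le> s \<Longrightarrow> s < t \<Longrightarrow> distributed M lborel (\<lambda>\<omega>. W t \<omega> - W s \<omega>) (normal_density 0 (sqrt (t - s)))"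
  using brownian by (simp add: brownian_motion_def)

lemma distr_minus_W_0: "0 \<le> t \<Longrightarrow> distr M borel (\<lambda>\<omega>. W t \<omega> - W 0 \<omega>) = distr M borel (W t)"
  using AE_W_0 by (intro distr_cong_AE) auto

lemma distr_increment:
  assumes "0 \<le> s" "s \<le> t"
  shows "distr M borel (\<lambda>\<omega>. W t \<omega> - W s \<omega>) = distr M borel (W (t - s))"
\<comment> \<open>Increments have a density only for \<open>s < t\<close>. For \<open>s = t\<close>
  both laws are the point mass at 0, because \<open>W 0\<close> vanishes almost surely.\<close>
proof (cases "s = t")
  case True
  then show ?thesis using AE_W_0 assms by (intro distr_cong_AE) auto
next
  case False
  have "distr M borel (\<lambda>\<omega>. W t \<omega> - W s \<omega>) = distr M lborel (\<lambda>\<omega>. W t \<omega> - W s \<omega>)"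
    by (rule distr_cong) auto
  also have "\<dots> = density lborel (normal_density 0 (sqrt (t - s)))"
    using distributed_increment[of s t] assms False by (intro distributed_distr_eq_density) auto
  also have "\<dots> = distr M lborel (\<lambda>\<omega>. W (t - s) \<omega> - W 0 \<omega>)"
    using distributed_increment[of 0 "t - s"] assms False
    by (intro distributed_distr_eq_density[symmetric]) auto
  also have "\<dots> = distr M borel (\<lambda>\<omega>. W (t - s) \<omega> - W 0 \<omega>)"
    by (rule distr_cong) auto
  finally show ?thesis using assms by (simp add: distr_minus_W_0)
qed

lemma distr_W_increment:
  assumes "0 \<le> s" "s \<le> t"
  shows "distr M (borel \<Otimes>\<^sub>M borel) (\<lambda>\<omega>. (W s \<omega>, W t \<omega> - W s \<omega>)) =
    distr M borel (W s) \<Otimes>\<^sub>M distr M borel (W (t - s))"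
proof -
  have [measurable]: "W s \<in> borel_measurable M" "W t \<in> borel_measurable M" "W 0 \<in> borel_measurable M"
    using assms by auto
  \<comment> \<open>The time points 0, \<open>s\<close>, \<open>t\<close>: increment 0 is
    \<open>W s - W 0\<close> and increment 1 is \<open>W t - W s\<close>.\<close>
  define T where "T i = (if i = 0 then 0 else if i = 1 then s else t)" for i :: nat
  have "0 \<le> T 0 \<and> (\<forall>i<2. T i \<le> T (Suc i))"
    using assms by (auto simp: T_def)
  then have "indep_vars (\<lambda>_. borel) (\<lambda>i \<omega>. W (T (Suc i)) \<omega> - W (T i) \<omega>) {..<2}"
    using brownian unfolding brownian_motion_def by blast
  from indep_var_of_indep_vars[OF this, of 0 1]
  have "indep_var borel (\<lambda>\<omega>. W s \<omega> - W 0 \<omega>) borel (\<lambda>\<omega>. W t \<omega> - W s \<omega>)"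
    by (simp add: T_def)
  then have "distr M (borel \<Otimes>\<^sub>M borel) (\<lambda>\<omega>. (W s \<omega> - W 0 \<omega>, W t \<omega> - W s \<omega>)) =
      distr M borel (\<lambda>\<omega>. W s \<omega> - W 0 \<omega>) \<Otimes>\<^sub>M distr M borel (\<lambda>\<omega>. W t \<omega> - W s \<omega>)"
    by (simp add: indep_var_distribution_eq)
  also have "distr M (borel \<Otimes>\<^sub>M borel) (\<lambda>\<omega>. (W s \<omega> - W 0 \<omega>, W t \<omega> - W s \<omega>)) =
      distr M (borel \<Otimes>\<^sub>M borel) (\<lambda>\<omega>. (W s \<omega>, W t \<omega> - W s \<omega>))"
    using AE_W_0 by (intro distr_cong_AE) auto
  finally show ?thesis
    using assms by (simp add: distr_minus_W_0 distr_increment)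
qed

lemma expectation_increment:
  fixes \<phi> :: "real \<Rightarrow> real"
  assumes "0 \<le> s" "s \<le> t" and [measurable]: "\<phi> \<in> borel_measurable borel"
  shows "expectation (\<lambda>\<omega>. \<phi> (W t \<omega> - W s \<omega>)) = expectation (\<lambda>\<omega>. \<phi> (W (t - s) \<omega>))"
proof -
  have [measurable]: "W s \<in> borel_measurable M" "W t \<in> borel_measurable M" "W (t - s) \<in> borel_measurable M"
    using assms by auto
  have "expectation (\<lambda>\<omega>. \<phi> (W t \<omega> - W s \<omega>)) = (\<integral>z. \<phi> z \<partial>distr M borel (\<lambda>\<omega>. W t \<omega> - W s \<omega>))"
    by (subst integral_distr) auto
  also have "\<dots> = expectation (\<lambda>\<omega>. \<phi> (W (t - s) \<omega>))"
    unfolding distr_increment[OF assms(1,2)] by (subst integral_distr) auto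
  finally show ?thesis .
qed

text \<open>Fubini for the product law of \<open>W s\<close> and the increment: the past is frozen
  and the increment is replaced by a fresh copy of \<open>W (t - s)\<close>. Both the semigroup law
  and the conditional expectation rest on this.\<close>

lemma expectation_markov:
  fixes \<phi> :: "real \<Rightarrow> real \<Rightarrow> real"
  assumes "0 \<le> s" "s \<le> t" and [measurable]: "case_prod \<phi> \<in> borel_measurable (borel \<Otimes>\<^sub>M borel)"
    and B: "\<And>x y. \<bar>\<phi> x y\<bar> \<le> B"
  shows "expectation (\<lambda>\<omega>. \<phi> (W s \<omega>) (W t \<omega> - W s \<omega>)) =
    expectation (\<lambda>\<omega>. expectation (\<lambda>\<omega>'. \<phi> (W s \<omega>) (W (t - s) \<omega>')))"
proof -
  have [measurable]: "W s \<in> borel_measurable M" "W t \<in> borel_measurable M" "W (t - s) \<in> borel_measurable M"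
    using assms by auto
  let ?D = "distr M borel (W s)" and ?E = "distr M borel (W (t - s))"
  interpret D: prob_space ?D by (rule prob_space_distr) simp
  interpret E: prob_space ?E by (rule prob_space_distr) simp
  interpret P: pair_prob_space ?D ?E ..
  have int: "integrable (?D \<Otimes>\<^sub>M ?E) (case_prod \<phi>)"
    by (rule P.integrable_const_bound[of _ B]) (use B in auto)
  have "expectation (\<lambda>\<omega>. \<phi> (W s \<omega>) (W t \<omega> - W s \<omega>)) =
      (\<integral>z. case_prod \<phi> z \<partial>distr M (borel \<Otimes>\<^sub>M borel) (\<lambda>\<omega>. (W s \<omega>, W t \<omega> - W s \<omega>)))"
    by (subst integral_distr) auto
  also have "\<dots> = (\<integral>x. (\<integral>y. \<phi> x y \<partial>?E) \<partial>?D)"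
    unfolding distr_W_increment[OF assms(1,2)] using P.integral_fst'[OF int] by simp
  also have "\<dots> = expectation (\<lambda>\<omega>. expectation (\<lambda>\<omega>'. \<phi> (W s \<omega>) (W (t - s) \<omega>')))"
  proof (subst integral_distr)
    show "(\<lambda>x. \<integral>y. \<phi> x y \<partial>?E) \<in> borel_measurable borel"
      by measurable
    show "expectation (\<lambda>\<omega>. \<integral>y. \<phi> (W s \<omega>) y \<partial>?E) =
        expectation (\<lambda>\<omega>. expectation (\<lambda>\<omega>'. \<phi> (W s \<omega>) (W (t - s) \<omega>')))"
      by (intro Bochner_Integration.integral_cong refl integral_distr) auto
  qed simp
  finally show ?thesis .
qed

lemma W_moments:
  assumes "\<tau> > 0"
  shows "integrable M (\<lambda>\<omega>. W \<tau> \<omega>)" "expectation (W \<tau>) = 0"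
    "integrable M (\<lambda>\<omega>. (W \<tau> \<omega>)\<^sup>2)" "expectation (\<lambda>\<omega>. (W \<tau> \<omega>)\<^sup>2) = \<tau>"
    "integrable M (\<lambda>\<omega>. \<bar>W \<tau> \<omega>\<bar> ^ 3)" "expectation (\<lambda>\<omega>. \<bar>W \<tau> \<omega>\<bar> ^ 3) \<le> 2 * sqrt \<tau> ^ 3"
proof -
  let ?\<phi> = "normal_density 0 (sqrt \<tau>)"
  have [measurable]: "W \<tau> \<in> borel_measurable M" "W 0 \<in> borel_measurable M"
    using assms by auto
  have D: "distributed M lborel (\<lambda>\<omega>. W \<tau> \<omega> - W 0 \<omega>) ?\<phi>"
    using distributed_increment[of 0 \<tau>] assms by simp
  \<comment> \<open>The density belongs to \<open>W \<tau> - W 0\<close>; it carries over to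
    \<open>W \<tau>\<close> because the two agree almost surely.\<close>
  have exp_eq: "expectation (\<lambda>\<omega>. f (W \<tau> \<omega>)) = (\<integral>x. ?\<phi> x * f x \<partial>lborel)"
    and int_iff: "integrable M (\<lambda>\<omega>. f (W \<tau> \<omega>)) \<longleftrightarrow> integrable lborel (\<lambda>x. ?\<phi> x * f x)"
    if [measurable]: "f \<in> borel_measurable borel" for f :: "real \<Rightarrow> real"
  proof -
    have eq: "AE \<omega> in M. f (W \<tau> \<omega>) = f (W \<tau> \<omega> - W 0 \<omega>)"
      using AE_W_0 by eventually_elim simp
    show "expectation (\<lambda>\<omega>. f (W \<tau> \<omega>)) = (\<integral>x. ?\<phi> x * f x \<partial>lborel)"
      using integral_cong_AE[OF _ _ eq] distributed_integral[OF D, of f] by simp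
    show "integrable M (\<lambda>\<omega>. f (W \<tau> \<omega>)) \<longleftrightarrow> integrable lborel (\<lambda>x. ?\<phi> x * f x)"
      using integrable_cong_AE[OF _ _ eq] distributed_integrable[OF D, of f] by simp
  qed
  have pos: "sqrt \<tau> > 0" using assms by simp
  show "integrable M (\<lambda>\<omega>. W \<tau> \<omega>)"
    using int_iff[of "\<lambda>x. x"] integrable_normal_moment[OF pos, of 0 1] by simp
  show "expectation (W \<tau>) = 0"
    using exp_eq[of "\<lambda>x. x"] integral_normal_moment_odd[OF pos, of 0 0] by simp
  show "integrable M (\<lambda>\<omega>. (W \<tau> \<omega>)\<^sup>2)"
    using int_iff[of "\<lambda>x. x\<^sup>2"] integrable_normal_moment[OF pos, of 0 2] by simp
  show "expectation (\<lambda>\<omega>. (W \<tau> \<omega>)\<^sup>2) = \<tau>"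
    using exp_eq[of "\<lambda>x. x\<^sup>2"] integral_normal_moment_even[OF pos, of 0 1] assms by simp
  show "integrable M (\<lambda>\<omega>. \<bar>W \<tau> \<omega>\<bar> ^ 3)"
    using int_iff[of "\<lambda>x. \<bar>x\<bar> ^ 3"] integrable_normal_moment_abs[OF pos, of 0 3] by simp
  \<comment> \<open>The exact Gaussian moment; its factor \<open>sqrt (2 / pi)\<close> is at most 1
    and is dropped next.\<close>
  have "expectation (\<lambda>\<omega>. \<bar>W \<tau> \<omega>\<bar> ^ 3) = 2 * sqrt \<tau> ^ 3 * sqrt (2 / pi)"
    using exp_eq[of "\<lambda>x. \<bar>x\<bar> ^ 3"] integral_normal_moment_abs_odd[OF pos, of 0 1] by simp
  also have "\<dots> \<le> 2 * sqrt \<tau> ^ 3"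
    using assms pi_ge_two by (intro mult_left_le) auto
  finally show "expectation (\<lambda>\<omega>. \<bar>W \<tau> \<omega>\<bar> ^ 3) \<le> 2 * sqrt \<tau> ^ 3" .
qed

section \<open>The semigroup of Brownian motion with drift\<close>

definition heat :: "real \<Rightarrow> real \<Rightarrow> real \<Rightarrow> (real \<Rightarrow> real) \<Rightarrow> real \<Rightarrow> real" where
  "heat \<beta> \<sigma> \<tau> h y = expectation (\<lambda>\<omega>. h (y + \<beta> * \<tau> + \<sigma> * W \<tau> \<omega>))"

lemma heat_0:
  assumes [measurable]: "h \<in> borel_measurable borel"
  shows "heat \<beta> \<sigma> 0 h y = h y"
proof -
  have "expectation (\<lambda>\<omega>. h (y + \<beta> * 0 + \<sigma> * W 0 \<omega>)) = expectation (\<lambda>_. h y)"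
    using AE_W_0 by (intro integral_cong_AE) (auto elim!: eventually_mono)
  then show ?thesis by (simp add: heat_def prob_space)
qed

lemma borel_measurable_heat [measurable]:
  assumes "0 \<le> \<tau>" and [measurable]: "h \<in> borel_measurable borel"
  shows "heat \<beta> \<sigma> \<tau> h \<in> borel_measurable borel"
proof -
  have [measurable]: "W \<tau> \<in> borel_measurable M" using assms by simp
  show ?thesis unfolding heat_def by measurable
qed

lemma integrable_heat:
  assumes "0 \<le> \<tau>" and [measurable]: "h \<in> borel_measurable borel" and "\<And>y. \<bar>h y\<bar> \<le> (B::real)"
  shows "integrable M (\<lambda>\<omega>. h (y + \<beta> * \<tau> + \<sigma> * W \<tau> \<omega>))"
proof -
  have [measurable]: "W \<tau> \<in> borel_measurable M" using assms by simp
  show ?thesis by (rule integrable_const_bound[of _ B]) (use assms in auto)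
qed

lemma expectation_diff_le:
  fixes f g :: "'a \<Rightarrow> real"
  assumes "integrable M f" "integrable M g" "\<And>\<omega>. \<bar>f \<omega> - g \<omega>\<bar> \<le> e"
  shows "\<bar>expectation f - expectation g\<bar> \<le> e"
proof -
  have "\<bar>expectation f - expectation g\<bar> = \<bar>expectation (\<lambda>\<omega>. f \<omega> - g \<omega>)\<bar>"
    using assms by simp
  also have "\<dots> \<le> expectation (\<lambda>\<omega>. \<bar>f \<omega> - g \<omega>\<bar>)"
    by (rule integral_abs_bound)
  also have "\<dots> \<le> expectation (\<lambda>_. e)"
    using assms by (intro integral_mono) auto
  finally show ?thesis by (simp add: prob_space)
qed

lemma heat_contraction:
  assumes "0 \<le> \<tau>" "h1 \<in> borel_measurable borel" "h2 \<in> borel_measurable borel"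
    and "\<And>y. \<bar>h1 y\<bar> \<le> B1" "\<And>y. \<bar>h2 y\<bar> \<le> B2"
    and "\<And>y. \<bar>h1 y - h2 y\<bar> \<le> e"
  shows "\<bar>heat \<beta> \<sigma> \<tau> h1 y - heat \<beta> \<sigma> \<tau> h2 y\<bar> \<le> e"
  unfolding heat_def
  by (intro expectation_diff_le integrable_heat[OF assms(1,2,4)] integrable_heat[OF assms(1,3,5)] assms(6))

lemma abs_heat_le:
  assumes "0 \<le> \<tau>" "h \<in> borel_measurable borel" "\<And>y. \<bar>h y\<bar> \<le> B"
  shows "\<bar>heat \<beta> \<sigma> \<tau> h y\<bar> \<le> B"
  using heat_contraction[OF assms(1,2), of "\<lambda>_. 0" B 0 B] assms(3) by (simp add: heat_def)

text \<open>Split \<open>W (s + t)\<close> into \<open>W s\<close> and an increment, then freeze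
  \<open>W s\<close> by \<open>expectation_markov\<close>.\<close>

lemma heat_semigroup:
  assumes "0 \<le> s" "0 \<le> t" and [measurable]: "h \<in> borel_measurable borel" and B: "\<And>y. \<bar>h y\<bar> \<le> B"
  shows "heat \<beta> \<sigma> (s + t) h y = heat \<beta> \<sigma> s (heat \<beta> \<sigma> t h) y"
proof -
  let ?\<phi> = "\<lambda>v w. h (y + \<beta> * s + \<sigma> * v + \<beta> * t + \<sigma> * w)"
  have "heat \<beta> \<sigma> (s + t) h y = expectation (\<lambda>\<omega>. ?\<phi> (W s \<omega>) (W (s + t) \<omega> - W s \<omega>))"
    unfolding heat_def by (simp add: algebra_simps)
  also have "\<dots> = expectation (\<lambda>\<omega>. expectation (\<lambda>\<omega>'. ?\<phi> (W s \<omega>) (W (s + t - s) \<omega>')))"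
    using assms by (intro expectation_markov) auto
  also have "\<dots> = heat \<beta> \<sigma> s (heat \<beta> \<sigma> t h) y"
    by (simp add: heat_def)
  finally show ?thesis .
qed

text \<open>The variance of the absolute value is nonnegative, so the first absolute moment is at
  most the root of the second moment.\<close>

lemma expectation_abs_W_le:
  assumes "\<tau> > 0"
  shows "integrable M (\<lambda>\<omega>. \<bar>W \<tau> \<omega>\<bar>)" "expectation (\<lambda>\<omega>. \<bar>W \<tau> \<omega>\<bar>) \<le> sqrt \<tau>"
proof -
  note mom = W_moments[OF assms]
  show int: "integrable M (\<lambda>\<omega>. \<bar>W \<tau> \<omega>\<bar>)" using mom(1) by simp
  have "(expectation (\<lambda>\<omega>. \<bar>W \<tau> \<omega>\<bar>))\<^sup>2 \<le> expectation (\<lambda>\<omega>. \<bar>W \<tau> \<omega>\<bar>\<^sup>2)"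
    using variance_eq[OF int] variance_positive[of "\<lambda>\<omega>. \<bar>W \<tau> \<omega>\<bar>"] mom(3) by simp
  then show "expectation (\<lambda>\<omega>. \<bar>W \<tau> \<omega>\<bar>) \<le> sqrt \<tau>"
    using mom(4) by (intro real_le_rsqrt) simp
qed

text \<open>Both times are evaluated on the same Brownian path, so the Lipschitz bound for
  \<open>F\<close> leaves only the mean absolute increment. This later absorbs the rounding of the
  remaining time to the grid.\<close>

lemma heat_time_modulus:
  assumes F: "C3_bounded_by K F F1 F2 F3"
    and "0 \<le> s" "s \<le> t" "t - s \<le> \<Delta>"
  shows "\<bar>heat \<beta> \<sigma> t F y - heat \<beta> \<sigma> s F y\<bar> \<le> K * (\<bar>\<beta>\<bar> * \<Delta> + \<bar>\<sigma>\<bar> * sqrt \<Delta>)"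
proof (cases "s = t")
  case True
  moreover have "0 \<le> K" using F unfolding C3_bounded_by_def by (meson abs_ge_zero order_trans)
  ultimately show ?thesis using assms by simp
next
  case False
  define \<delta> where "\<delta> = t - s"
  have \<delta>: "\<delta> > 0" "\<delta> \<le> \<Delta>" using False assms by (auto simp: \<delta>_def)
  have "0 \<le> K" using F unfolding C3_bounded_by_def by (meson abs_ge_zero order_trans)
  have [measurable]: "W s \<in> borel_measurable M" "W t \<in> borel_measurable M" "W \<delta> \<in> borel_measurable M"
    using assms \<delta> by auto
  note [measurable] = C3_borel_measurable[OF F]
  have lip: "\<bar>F a - F b\<bar> \<le> K * \<bar>a - b\<bar>" for a b
    by (rule C3_lipschitz[OF F])
  have "distr M borel (\<lambda>\<omega>. W t \<omega> - W s \<omega>) = distr M borel (W \<delta>)"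
    unfolding \<delta>_def using assms by (intro distr_increment)
  then have int: "integrable M (\<lambda>\<omega>. \<bar>W t \<omega> - W s \<omega>\<bar>)"
    using expectation_abs_W_le(1)[OF \<delta>(1)]
      integrable_distr_eq[of "\<lambda>\<omega>. W t \<omega> - W s \<omega>" M borel "\<lambda>x. \<bar>x\<bar>"]
      integrable_distr_eq[of "W \<delta>" M borel "\<lambda>x. \<bar>x\<bar>"] by simp
  have int_heat: "integrable M (\<lambda>\<omega>. F (y + \<beta> * u + \<sigma> * W u \<omega>))" if "0 \<le> u" for u
    using F that unfolding C3_bounded_by_def by (intro integrable_heat[of _ _ K]) auto
  have "\<bar>heat \<beta> \<sigma> t F y - heat \<beta> \<sigma> s F y\<bar> =
      \<bar>expectation (\<lambda>\<omega>. F (y + \<beta> * t + \<sigma> * W t \<omega>) - F (y + \<beta> * s + \<sigma> * W s \<omega>))\<bar>"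
    unfolding heat_def using int_heat assms by simp
  also have "\<dots> \<le> expectation (\<lambda>\<omega>. K * (\<bar>\<beta>\<bar> * \<delta> + \<bar>\<sigma>\<bar> * \<bar>W t \<omega> - W s \<omega>\<bar>))"
  proof (rule order_trans[OF integral_abs_bound], rule integral_mono)
    fix \<omega>
    let ?a = "y + \<beta> * t + \<sigma> * W t \<omega>" and ?b = "y + \<beta> * s + \<sigma> * W s \<omega>"
    have "\<bar>?a - ?b\<bar> = \<bar>\<beta> * \<delta> + \<sigma> * (W t \<omega> - W s \<omega>)\<bar>"
      by (simp add: \<delta>_def algebra_simps)
    also have "\<dots> \<le> \<bar>\<beta>\<bar> * \<delta> + \<bar>\<sigma>\<bar> * \<bar>W t \<omega> - W s \<omega>\<bar>"
      using \<delta> abs_triangle_ineq[of "\<beta> * \<delta>" "\<sigma> * (W t \<omega> - W s \<omega>)"] by (simp add: abs_mult)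
    finally show "\<bar>F ?a - F ?b\<bar> \<le> K * (\<bar>\<beta>\<bar> * \<delta> + \<bar>\<sigma>\<bar> * \<bar>W t \<omega> - W s \<omega>\<bar>)"
      using lip[of ?a ?b] \<open>0 \<le> K\<close> by (meson mult_left_mono order_trans)
  qed (use int int_heat assms in auto)
  also have "\<dots> = K * (\<bar>\<beta>\<bar> * \<delta> + \<bar>\<sigma>\<bar> * expectation (\<lambda>\<omega>. \<bar>W t \<omega> - W s \<omega>\<bar>))"
    using int by (simp add: prob_space)
  also have "expectation (\<lambda>\<omega>. \<bar>W t \<omega> - W s \<omega>\<bar>) = expectation (\<lambda>\<omega>. \<bar>W \<delta> \<omega>\<bar>)"
    unfolding \<delta>_def using assms by (intro expectation_increment) auto
  also have "K * (\<bar>\<beta>\<bar> * \<delta> + \<bar>\<sigma>\<bar> * expectation (\<lambda>\<omega>. \<bar>W \<delta> \<omega>\<bar>)) \<le> K * (\<bar>\<beta>\<bar> * \<Delta> + \<bar>\<sigma>\<bar> * sqrt \<Delta>)"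
    using expectation_abs_W_le(2)[OF \<delta>(1)] \<delta>(2) \<open>0 \<le> K\<close>
    by (intro mult_left_mono add_mono) (auto intro: order_trans)
  finally show ?thesis .
qed

text \<open>Taylor's formula at \<open>y\<close>, integrated: the first Gaussian moment vanishes,
  the second is \<open>\<tau>\<close>, and the remainder is cubic. In the bound, 4 comes from
  \<open>cube_add_le\<close> and 2 from the third absolute moment.\<close>

lemma heat_expansion:
  assumes F: "C3_bounded_by K F F1 F2 F3" and "\<tau> > 0"
  shows "\<bar>heat \<beta> \<sigma> \<tau> F y - (F y + F1 y * (\<beta> * \<tau>) + F2 y * (\<beta>\<^sup>2 * \<tau>\<^sup>2 + \<sigma>\<^sup>2 * \<tau>) / 2)\<bar>
    \<le> K * (4 * (\<bar>\<beta>\<bar> ^ 3 * \<tau> ^ 3 + 2 * \<bar>\<sigma>\<bar> ^ 3 * sqrt \<tau> ^ 3))"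
proof -
  note mom = W_moments[OF \<open>\<tau> > 0\<close>]
  have "0 \<le> K" using F unfolding C3_bounded_by_def by (meson abs_ge_zero order_trans)
  have [measurable]: "W \<tau> \<in> borel_measurable M" using \<open>\<tau> > 0\<close> by simp
  note [measurable] = C3_borel_measurable[OF F]
  let ?P = "\<lambda>\<omega>. F y + F1 y * (\<beta> * \<tau> + \<sigma> * W \<tau> \<omega>) + F2 y * (\<beta> * \<tau> + \<sigma> * W \<tau> \<omega>)\<^sup>2 / 2"
  \<comment> \<open>Sorted by powers of \<open>W \<tau>\<close>, the Taylor polynomial can be
    integrated with the moments alone.\<close>
  have P_eq: "?P = (\<lambda>\<omega>. (F y + F1 y * (\<beta> * \<tau>) + F2 y * (\<beta>\<^sup>2 * \<tau>\<^sup>2) / 2)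
      + (F1 y * \<sigma> + F2 y * \<beta> * \<tau> * \<sigma>) * W \<tau> \<omega> + (F2 y * \<sigma>\<^sup>2 / 2) * (W \<tau> \<omega>)\<^sup>2)"
    by (auto simp: fun_eq_iff power2_eq_square field_simps)
  have P: "integrable M ?P"
    "expectation ?P = F y + F1 y * (\<beta> * \<tau>) + F2 y * (\<beta>\<^sup>2 * \<tau>\<^sup>2 + \<sigma>\<^sup>2 * \<tau>) / 2"
    unfolding P_eq using mom by (simp_all add: prob_space algebra_simps add_divide_distrib)
  have int_heat: "integrable M (\<lambda>\<omega>. F (y + \<beta> * \<tau> + \<sigma> * W \<tau> \<omega>))"
    using F \<open>\<tau> > 0\<close> unfolding C3_bounded_by_def by (intro integrable_heat[of _ _ K]) auto
  have "\<bar>heat \<beta> \<sigma> \<tau> F y - expectation ?P\<bar> = \<bar>expectation (\<lambda>\<omega>. F (y + \<beta> * \<tau> + \<sigma> * W \<tau> \<omega>) - ?P \<omega>)\<bar>"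
    unfolding heat_def by (subst Bochner_Integration.integral_diff[OF int_heat P(1)]) (rule refl)
  also have "\<dots> \<le> expectation (\<lambda>\<omega>. K * (4 * (\<bar>\<beta>\<bar> ^ 3 * \<tau> ^ 3 + \<bar>\<sigma>\<bar> ^ 3 * \<bar>W \<tau> \<omega>\<bar> ^ 3)))"
  proof (rule order_trans[OF integral_abs_bound], rule integral_mono)
    fix \<omega>
    let ?a = "\<beta> * \<tau>" and ?b = "\<sigma> * W \<tau> \<omega>"
    have "\<bar>F (y + ?a + ?b) - ?P \<omega>\<bar> \<le> K * \<bar>?a + ?b\<bar> ^ 3"
      using C3_taylor[OF F, of y "?a + ?b"] by (simp add: add.assoc)
    also have "\<dots> \<le> K * (\<bar>?a\<bar> + \<bar>?b\<bar>) ^ 3"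
      using \<open>0 \<le> K\<close> by (intro mult_left_mono power_mono) auto
    also have "\<dots> \<le> K * (4 * (\<bar>?a\<bar> ^ 3 + \<bar>?b\<bar> ^ 3))"
      using \<open>0 \<le> K\<close> by (intro mult_left_mono cube_add_le) auto
    finally show "\<bar>F (y + ?a + ?b) - ?P \<omega>\<bar> \<le> K * (4 * (\<bar>\<beta>\<bar> ^ 3 * \<tau> ^ 3 + \<bar>\<sigma>\<bar> ^ 3 * \<bar>W \<tau> \<omega>\<bar> ^ 3))"
      using \<open>\<tau> > 0\<close> by (simp add: abs_mult power_mult_distrib)
  qed (use int_heat P(1) mom(5) in auto)
  also have "\<dots> = K * (4 * (\<bar>\<beta>\<bar> ^ 3 * \<tau> ^ 3 + \<bar>\<sigma>\<bar> ^ 3 * expectation (\<lambda>\<omega>. \<bar>W \<tau> \<omega>\<bar> ^ 3)))"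
    using mom(5) by (simp add: prob_space)
  also have "\<dots> \<le> K * (4 * (\<bar>\<beta>\<bar> ^ 3 * \<tau> ^ 3 + \<bar>\<sigma>\<bar> ^ 3 * (2 * sqrt \<tau> ^ 3)))"
    using mom(6) \<open>0 \<le> K\<close> by (intro mult_left_mono add_left_mono) auto
  also have "\<dots> = K * (4 * (\<bar>\<beta>\<bar> ^ 3 * \<tau> ^ 3 + 2 * \<bar>\<sigma>\<bar> ^ 3 * sqrt \<tau> ^ 3))"
    by simp
  finally show ?thesis unfolding P(2) .
qed

end

subsection \<open>Convergence of the iterated binomial operator\<close>

text \<open>\<open>binomial_step\<close> in the logarithmic variable. Multiplications become
  translations, and translations commute with \<open>heat\<close>.\<close>

definition shift_step :: "real \<Rightarrow> real \<Rightarrow> real \<Rightarrow> (real \<Rightarrow> real) \<Rightarrow> real \<Rightarrow> real" where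
  "shift_step p a b h y = p * h (y + a) + (1 - p) * h (y + b)"

lemma binomial_step_funpow_exp:
  assumes "u > 0" "d > 0"
  shows "(binomial_step p u d ^^ n) \<phi> (exp y) = (shift_step p (ln u) (ln d) ^^ n) (\<lambda>y. \<phi> (exp y)) y"
proof (induction n arbitrary: y)
  case (Suc n)
  have "(binomial_step p u d ^^ Suc n) \<phi> (exp y) =
      p * (binomial_step p u d ^^ n) \<phi> (exp (y + ln u))
      + (1 - p) * (binomial_step p u d ^^ n) \<phi> (exp (y + ln d))"
    using assms by (simp add: binomial_step_def exp_add)
  then show ?case by (simp add: Suc shift_step_def)
qed simp

lemma shift_step_contraction:
  assumes "0 \<le> p" "p \<le> 1" "\<And>y. \<bar>h1 y - h2 y\<bar> \<le> e"
  shows "\<bar>shift_step p a b h1 y - shift_step p a b h2 y\<bar> \<le> e"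
proof -
  have "shift_step p a b h1 y - shift_step p a b h2 y =
      p * (h1 (y + a) - h2 (y + a)) + (1 - p) * (h1 (y + b) - h2 (y + b))"
    by (simp add: shift_step_def algebra_simps)
  also have "\<bar>\<dots>\<bar> \<le> \<bar>p * (h1 (y + a) - h2 (y + a))\<bar> + \<bar>(1 - p) * (h1 (y + b) - h2 (y + b))\<bar>"
    by (rule abs_triangle_ineq)
  also have "\<dots> \<le> p * e + (1 - p) * e"
    using assms by (auto simp: abs_mult intro!: add_mono mult_left_mono)
  finally show ?thesis by (simp add: algebra_simps)
qed

lemma shift_step_funpow_contraction:
  assumes "0 \<le> p" "p \<le> 1" "\<And>y. \<bar>h1 y - h2 y\<bar> \<le> e"
  shows "\<bar>(shift_step p a b ^^ n) h1 y - (shift_step p a b ^^ n) h2 y\<bar> \<le> e"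
  using assms(3) by (induction n arbitrary: y) (auto intro!: shift_step_contraction assms(1,2))

lemma abs_shift_step_funpow_le:
  assumes "0 \<le> p" "p \<le> 1" "\<And>y. \<bar>h y\<bar> \<le> B"
  shows "\<bar>(shift_step p a b ^^ n) h y\<bar> \<le> B"
proof -
  have "(shift_step p a b ^^ n) (\<lambda>_. 0) = (\<lambda>_. 0)"
    by (induction n) (auto simp: shift_step_def)
  with shift_step_funpow_contraction[of p h "\<lambda>_. 0" B n a b y] assms show ?thesis by simp
qed

lemma borel_measurable_shift_step:
  assumes [measurable]: "h \<in> borel_measurable borel"
  shows "shift_step p a b h \<in> borel_measurable borel"
  unfolding shift_step_def by measurable

lemma borel_measurable_shift_step_funpow:
  "h \<in> borel_measurable borel \<Longrightarrow> (shift_step p a b ^^ n) h \<in> borel_measurable borel"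
  by (induction n) (auto intro: borel_measurable_shift_step)

text \<open>The weighted Taylor formulas of the two translations. The shape agrees with
  \<open>heat_expansion\<close>, so comparing the operators reduces to comparing moments.\<close>

lemma shift_step_expansion:
  assumes F: "C3_bounded_by K F F1 F2 F3" and "0 \<le> p" "p \<le> 1"
  shows "\<bar>shift_step p a b F y -
      (F y + F1 y * (p * a + (1 - p) * b) + F2 y * (p * a\<^sup>2 + (1 - p) * b\<^sup>2) / 2)\<bar>
    \<le> K * (p * \<bar>a\<bar> ^ 3 + (1 - p) * \<bar>b\<bar> ^ 3)"
proof -
  let ?R = "\<lambda>a. F (y + a) - (F y + F1 y * a + F2 y * a\<^sup>2 / 2)"
  have "shift_step p a b F y -
      (F y + F1 y * (p * a + (1 - p) * b) + F2 y * (p * a\<^sup>2 + (1 - p) * b\<^sup>2) / 2) =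
      p * ?R a + (1 - p) * ?R b"
    by (simp add: shift_step_def field_simps)
  also have "\<bar>\<dots>\<bar> \<le> \<bar>p * ?R a\<bar> + \<bar>(1 - p) * ?R b\<bar>"
    by (rule abs_triangle_ineq)
  also have "\<dots> = p * \<bar>?R a\<bar> + (1 - p) * \<bar>?R b\<bar>"
    using assms by (simp add: abs_mult)
  also have "\<dots> \<le> p * (K * \<bar>a\<bar> ^ 3) + (1 - p) * (K * \<bar>b\<bar> ^ 3)"
    using assms by (intro add_mono mult_left_mono C3_taylor[OF F]) auto
  finally show ?thesis by (simp add: algebra_simps)
qed

context brownian
begin

lemma heat_shift_step:
  assumes "0 \<le> \<tau>" "h \<in> borel_measurable borel" "\<And>y. \<bar>h y\<bar> \<le> B"
  shows "heat \<beta> \<sigma> \<tau> (shift_step p a b h) y = shift_step p a b (heat \<beta> \<sigma> \<tau> h) y"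
proof -
  have "integrable M (\<lambda>\<omega>. h (y + \<beta> * \<tau> + \<sigma> * W \<tau> \<omega> + c))" for c
    using integrable_heat[OF assms, of "y + c" \<beta> \<sigma>] by (simp add: ac_simps)
  then show ?thesis
    by (simp add: heat_def shift_step_def ac_simps)
qed

lemma heat_shift_step_funpow:
  assumes "0 \<le> \<tau>" and h: "h \<in> borel_measurable borel" "\<And>y. \<bar>h y\<bar> \<le> B" and p: "0 \<le> p" "p \<le> 1"
  shows "heat \<beta> \<sigma> \<tau> ((shift_step p a b ^^ n) h) = (shift_step p a b ^^ n) (heat \<beta> \<sigma> \<tau> h)"
proof (induction n)
  case (Suc n)
  have "heat \<beta> \<sigma> \<tau> (shift_step p a b ((shift_step p a b ^^ n) h)) =
      shift_step p a b (heat \<beta> \<sigma> \<tau> ((shift_step p a b ^^ n) h))"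
    using assms
    by (intro ext heat_shift_step[of _ _ B] borel_measurable_shift_step_funpow abs_shift_step_funpow_le)
  with Suc show ?case by simp
qed simp

text \<open>Lindeberg's telescoping: the two operators commute and are contractions, so one-step errors
  add up.\<close>

lemma shift_step_funpow_heat:
  assumes "0 \<le> \<tau>" and h: "h \<in> borel_measurable borel" "\<And>y. \<bar>h y\<bar> \<le> B" and p: "0 \<le> p" "p \<le> 1"
    and e: "\<And>y. \<bar>shift_step p a b h y - heat \<beta> \<sigma> \<tau> h y\<bar> \<le> e"
  shows "\<bar>(shift_step p a b ^^ n) h y - heat \<beta> \<sigma> (real n * \<tau>) h y\<bar> \<le> real n * e"
proof (induction n arbitrary: y)
  case 0
  show ?case using heat_0[OF h(1)] by simp
next
  case (Suc n)
  let ?A = "shift_step p a b" and ?P = "heat \<beta> \<sigma>"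
  \<comment> \<open>The total error is split at the mixed term in which \<open>?A ^^ n\<close> acts
    on \<open>?P \<tau> h\<close>. The first part is a one-step error under a contraction; the
    second, after commuting, is \<open>?P \<tau>\<close> applied to the error of the induction
    hypothesis.\<close>
  have "\<bar>(?A ^^ n) (?A h) y - (?A ^^ n) (?P \<tau> h) y\<bar> \<le> e"
    by (rule shift_step_funpow_contraction[OF p e])
  moreover have "\<bar>?P \<tau> ((?A ^^ n) h) y - ?P \<tau> (?P (real n * \<tau>) h) y\<bar> \<le> real n * e"
    using assms(1) h p Suc
    by (intro heat_contraction[of _ _ _ B B] borel_measurable_shift_step_funpow
        borel_measurable_heat abs_shift_step_funpow_le abs_heat_le) auto
  moreover have "?P \<tau> (?P (real n * \<tau>) h) y = ?P (real (Suc n) * \<tau>) h y"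
    using heat_semigroup[of \<tau> "real n * \<tau>" h B] assms(1) h by (simp add: algebra_simps)
  moreover have "?P \<tau> ((?A ^^ n) h) = (?A ^^ n) (?P \<tau> h)"
    by (rule heat_shift_step_funpow[OF assms(1) h p])
  ultimately show ?case
    by (simp add: funpow_swap1 algebra_simps)
qed

lemma shift_step_heat_consistency:
  assumes F: "C3_bounded_by K F F1 F2 F3" and p: "0 \<le> p" "p \<le> 1" and "\<tau> > 0"
  shows "\<bar>shift_step p a b F y - heat \<beta> \<sigma> \<tau> F y\<bar> \<le>
    K * (\<bar>p * a + (1 - p) * b - \<beta> * \<tau>\<bar>
      + \<bar>p * a\<^sup>2 + (1 - p) * b\<^sup>2 - (\<beta>\<^sup>2 * \<tau>\<^sup>2 + \<sigma>\<^sup>2 * \<tau>)\<bar>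
      + (p * \<bar>a\<bar> ^ 3 + (1 - p) * \<bar>b\<bar> ^ 3)
      + 4 * (\<bar>\<beta>\<bar> ^ 3 * \<tau> ^ 3 + 2 * \<bar>\<sigma>\<bar> ^ 3 * sqrt \<tau> ^ 3))"
proof -
  let ?m1 = "p * a + (1 - p) * b" and ?m2 = "p * a\<^sup>2 + (1 - p) * b\<^sup>2"
  let ?n1 = "\<beta> * \<tau>" and ?n2 = "\<beta>\<^sup>2 * \<tau>\<^sup>2 + \<sigma>\<^sup>2 * \<tau>"
  \<comment> \<open>The common term \<open>f\<close> cancels; the factor 1/2 at second order is
    given away.\<close>
  have combine: "\<bar>x - w\<bar> \<le> c1 + c2 + e1 + e2"
    if "\<bar>x - (f + u1 + u2 / 2)\<bar> \<le> e1" "\<bar>w - (f + v1 + v2 / 2)\<bar> \<le> e2"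
      "\<bar>u1 - v1\<bar> \<le> c1" "\<bar>u2 - v2\<bar> \<le> c2" for x w f u1 u2 v1 v2 c1 c2 e1 e2 :: real
    using that by linarith
  have "\<bar>F1 y * ?m1 - F1 y * ?n1\<bar> \<le> K * \<bar>?m1 - ?n1\<bar>"
    using F unfolding C3_bounded_by_def right_diff_distrib[symmetric] abs_mult
    by (intro mult_right_mono) auto
  moreover have "\<bar>F2 y * ?m2 - F2 y * ?n2\<bar> \<le> K * \<bar>?m2 - ?n2\<bar>"
    using F unfolding C3_bounded_by_def right_diff_distrib[symmetric] abs_mult
    by (intro mult_right_mono) auto
  ultimately show ?thesis
    using combine[OF shift_step_expansion[OF F p] heat_expansion[OF F \<open>\<tau> > 0\<close>]]
    by (simp only: distrib_left)
qed

end

subsection \<open>Uniform convergence of the prices\<close>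

lemma power_half_squared: "1 / 2 ^ (2 * m) = (1 / 2 ^ m :: real)\<^sup>2"
  by (simp add: power_divide power_even_eq)

text \<open>Limits in \<open>m\<close> become limits in a real variable \<open>z\<close> tending to
  0 from the right, where asymptotic expansions apply.\<close>

lemma filterlim_power_half: "filterlim (\<lambda>m. 1 / 2 ^ m :: real) (at_right 0) sequentially"
  by real_asymp

lemma eventually_admissible:
  assumes "\<sigma> > 0"
  shows "eventually (admissible \<mu> \<sigma> r) sequentially"
proof -
  define \<kappa> where "\<kappa> = (r - \<mu>) / \<sigma>"
  have "eventually (\<lambda>z. 0 < 1 / 2 + 1 / 2 * \<kappa> * z) (at_right 0)"
    "eventually (\<lambda>z. 1 / 2 + 1 / 2 * \<kappa> * z < 1) (at_right 0)"
    "eventually (\<lambda>z. 0 < 1 - \<sigma> * z + \<mu> * z\<^sup>2) (at_right 0)"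
    by real_asymp+
  then have "eventually (\<lambda>z. 0 < 1 / 2 + 1 / 2 * \<kappa> * z \<and> 1 / 2 + 1 / 2 * \<kappa> * z < 1
      \<and> 0 < 1 - \<sigma> * z + \<mu> * z\<^sup>2) (at_right 0)"
    by eventually_elim auto
  from eventually_compose_filterlim[OF this filterlim_power_half] show ?thesis
    unfolding admissible_def[abs_def] by (simp add: q_plus_def down_factor_def \<kappa>_def power_half_squared[symmetric])
qed

text \<open>The bound of \<open>shift_step_heat_consistency\<close> without its factor
  \<open>K\<close>, at the parameters of the model. It depends neither on the test function nor on
  the point.\<close>

definition consistency_error :: "real \<Rightarrow> real \<Rightarrow> real \<Rightarrow> nat \<Rightarrow> real" where
  "consistency_error \<mu> \<sigma> r m =
    (let p = q_plus \<mu> \<sigma> r m; a = ln (up_factor \<mu> \<sigma> m); b = ln (down_factor \<mu> \<sigma> m);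
         \<beta> = r - \<sigma>\<^sup>2 / 2; \<tau> = 1 / 2 ^ (2 * m)
     in \<bar>p * a + (1 - p) * b - \<beta> * \<tau>\<bar>
      + \<bar>p * a\<^sup>2 + (1 - p) * b\<^sup>2 - (\<beta>\<^sup>2 * \<tau>\<^sup>2 + \<sigma>\<^sup>2 * \<tau>)\<bar>
      + (p * \<bar>a\<bar> ^ 3 + (1 - p) * \<bar>b\<bar> ^ 3)
      + 4 * (\<bar>\<beta>\<bar> ^ 3 * \<tau> ^ 3 + 2 * \<bar>\<sigma>\<bar> ^ 3 * sqrt \<tau> ^ 3))"

text \<open>With \<open>z = 1 / 2 ^ m\<close> one has \<open>2 * p z - 1 = \<kappa> * z\<close>. The
  mean log-return therefore has the coefficient
  \<open>\<kappa> * \<sigma> + \<mu> - \<sigma>\<^sup>2 / 2\<close>, which is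
  \<open>\<beta>\<close>, at order \<open>z\<^sup>2\<close>; the second moments share the
  coefficient \<open>\<sigma>\<^sup>2\<close>, and the remainder terms are of third order.\<close>

lemma consistency_error_limit:
  assumes "\<sigma> > 0"
  shows "(\<lambda>m. 2 ^ (2 * m) * consistency_error \<mu> \<sigma> r m) \<longlonglongrightarrow> 0"
proof -
  define \<kappa> where "\<kappa> = (r - \<mu>) / \<sigma>"
  \<comment> \<open>Eliminating \<open>r\<close> turns the cancellation at order
    \<open>z\<^sup>2\<close> into a polynomial identity in \<open>\<mu>\<close>,
    \<open>\<kappa>\<close> and \<open>\<sigma>\<close>.\<close>
  have r: "r = \<mu> + \<kappa> * \<sigma>" using assms by (simp add: \<kappa>_def)
  define \<beta> where "\<beta> = r - \<sigma>\<^sup>2 / 2"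
  have \<beta>: "\<beta> = \<mu> + \<kappa> * \<sigma> - \<sigma> * \<sigma> / 2" by (simp add: \<beta>_def r power2_eq_square)
  define p a b where "p z = 1 / 2 + 1 / 2 * \<kappa> * z" and "a z = ln (1 + \<sigma> * z + \<mu> * z\<^sup>2)"
    and "b z = ln (1 - \<sigma> * z + \<mu> * z\<^sup>2)" for z :: real
  define E1 E2 E3 E4 where "E1 z = p z * a z + (1 - p z) * b z - \<beta> * z\<^sup>2"
    and "E2 z = p z * (a z)\<^sup>2 + (1 - p z) * (b z)\<^sup>2 - (\<beta>\<^sup>2 * (z\<^sup>2)\<^sup>2 + \<sigma>\<^sup>2 * z\<^sup>2)"
    and "E3 z = p z * \<bar>a z\<bar> ^ 3 + (1 - p z) * \<bar>b z\<bar> ^ 3"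
    and "E4 z = 4 * (\<bar>\<beta>\<bar> ^ 3 * (z\<^sup>2) ^ 3 + 2 * \<bar>\<sigma>\<bar> ^ 3 * z ^ 3)" for z :: real
  have "((\<lambda>z. E1 z / z\<^sup>2) \<longlongrightarrow> 0) (at_right 0)"
    unfolding E1_def p_def a_def b_def \<beta> by real_asymp
  moreover have "((\<lambda>z. E2 z / z\<^sup>2) \<longlongrightarrow> 0) (at_right 0)"
    unfolding E2_def p_def a_def b_def using assms by real_asymp
  moreover have "((\<lambda>z. E3 z / z\<^sup>2) \<longlongrightarrow> 0) (at_right 0)"
    unfolding E3_def p_def a_def b_def using assms by real_asymp
  moreover have "((\<lambda>z. E4 z / z\<^sup>2) \<longlongrightarrow> 0) (at_right 0)"
    unfolding E4_def by real_asymp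
  ultimately have "((\<lambda>z. \<bar>E1 z / z\<^sup>2\<bar> + \<bar>E2 z / z\<^sup>2\<bar> + E3 z / z\<^sup>2 + E4 z / z\<^sup>2) \<longlongrightarrow> 0) (at_right 0)"
    by (intro tendsto_add_zero tendsto_rabs_zero)
  from filterlim_compose[OF this filterlim_power_half]
  have lim: "(\<lambda>m. \<bar>E1 (1 / 2 ^ m) / (1 / 2 ^ m)\<^sup>2\<bar> + \<bar>E2 (1 / 2 ^ m) / (1 / 2 ^ m)\<^sup>2\<bar>
      + E3 (1 / 2 ^ m) / (1 / 2 ^ m)\<^sup>2 + E4 (1 / 2 ^ m) / (1 / 2 ^ m)\<^sup>2) \<longlonglongrightarrow> 0" .
  have "2 ^ (2 * m) * consistency_error \<mu> \<sigma> r m =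
      \<bar>E1 (1 / 2 ^ m) / (1 / 2 ^ m)\<^sup>2\<bar> + \<bar>E2 (1 / 2 ^ m) / (1 / 2 ^ m)\<^sup>2\<bar>
      + E3 (1 / 2 ^ m) / (1 / 2 ^ m)\<^sup>2 + E4 (1 / 2 ^ m) / (1 / 2 ^ m)\<^sup>2" for m
  proof -
    define z :: real where "z = 1 / 2 ^ m"
    have "z > 0" by (simp add: z_def)
    have z: "q_plus \<mu> \<sigma> r m = p z" "ln (up_factor \<mu> \<sigma> m) = a z" "ln (down_factor \<mu> \<sigma> m) = b z"
      by (simp_all add: q_plus_def up_factor_def down_factor_def p_def a_def b_def \<kappa>_def z_def
          power_half_squared[symmetric])
    have tau: "1 / 2 ^ (2 * m) = z\<^sup>2" by (simp only: z_def power_half_squared)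
    have four: "2 ^ (2 * m) = 1 / z\<^sup>2" unfolding tau[symmetric] by simp
    have "consistency_error \<mu> \<sigma> r m = \<bar>E1 z\<bar> + \<bar>E2 z\<bar> + E3 z + E4 z"
      using \<open>z > 0\<close>
      by (simp add: consistency_error_def Let_def z tau E1_def E2_def E3_def E4_def \<beta>_def)
    then show ?thesis
      unfolding four z_def[symmetric] using \<open>z > 0\<close> by (simp add: abs_divide add_divide_distrib)
  qed
  with lim show ?thesis by simp
qed

text \<open>Discrete and continuous discount over one step agree to first order in the step length,
  so their difference stays negligible after multiplication by the number of steps.\<close>

lemma discount_error_limit:
  "(\<lambda>m. 2 ^ (2 * m) * \<bar>1 / rate_factor r m - exp (- r / 2 ^ (2 * m))\<bar>) \<longlonglongrightarrow> 0"
proof -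
  have "((\<lambda>z. \<bar>(1 / (1 + r * z\<^sup>2) - exp (- r * z\<^sup>2)) / z\<^sup>2\<bar>) \<longlongrightarrow> 0) (at_right 0)"
    by (intro tendsto_rabs_zero) real_asymp
  from filterlim_compose[OF this filterlim_power_half] show ?thesis
    by (simp add: rate_factor_def power_half_squared[symmetric] abs_mult mult.commute)
qed

lemma grid_index_bounds:
  assumes "0 \<le> t"
  shows "real (grid_index m t) \<le> t * 2 ^ (2 * m)" "t * 2 ^ (2 * m) < real (grid_index m t) + 1"
proof -
  have "real (grid_index m t) = of_int \<lfloor>t * 2 ^ (2 * m)\<rfloor>"
    using assms by (simp add: grid_index_def)
  then show "real (grid_index m t) \<le> t * 2 ^ (2 * m)" "t * 2 ^ (2 * m) < real (grid_index m t) + 1"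
    by linarith+
qed

lemma grid_index_mono: "t \<le> T \<Longrightarrow> grid_index m t \<le> grid_index m T"
  unfolding grid_index_def by (intro nat_mono floor_mono mult_right_mono) auto

text \<open>Powers of numbers in the unit interval differ by at most \<open>n\<close> times the
  difference of the bases. Passing from the grid time to \<open>\<rho>\<close> costs the last term,
  as \<open>exp\<close> is 1-Lipschitz on the nonpositive reals.\<close>

lemma discount_error:
  assumes "r > 0" "0 \<le> \<rho>" "\<bar>real n / 2 ^ (2 * m) - \<rho>\<bar> \<le> 1 / 2 ^ (2 * m)"
  shows "\<bar>(1 / rate_factor r m) ^ n - exp (- r * \<rho>)\<bar> \<le>
    real n * \<bar>1 / rate_factor r m - exp (- r / 2 ^ (2 * m))\<bar> + r / 2 ^ (2 * m)"
proof -
  define \<tau> :: real where "\<tau> = 1 / 2 ^ (2 * m)"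
  have "\<tau> > 0" by (simp add: \<tau>_def)
  have "norm ((1 / rate_factor r m) ^ n - exp (- r * \<tau>) ^ n) \<le> real n * norm (1 / rate_factor r m - exp (- r * \<tau>))"
  proof (rule norm_power_diff)
    have "1 \<le> rate_factor r m" using \<open>r > 0\<close> by (simp add: rate_factor_def)
    then show "norm (1 / rate_factor r m) \<le> 1" by simp
    show "norm (exp (- r * \<tau>)) \<le> 1" using \<open>r > 0\<close> \<open>\<tau> > 0\<close> by simp
  qed
  moreover have "exp (- r * \<tau>) ^ n = exp (- (r * (real n * \<tau>)))"
    by (simp add: exp_of_nat_mult[symmetric] ac_simps)
  moreover have "\<bar>exp (- (r * (real n * \<tau>))) - exp (- (r * \<rho>))\<bar> \<le> r * \<tau>"
  proof -
    have "norm (exp (- (r * (real n * \<tau>))) - exp (- (r * \<rho>))) \<le> 1 * norm (- (r * (real n * \<tau>)) - - (r * \<rho>))"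
      by (rule field_differentiable_bound[of "{..0}" exp exp])
        (use assms \<open>\<tau> > 0\<close> in \<open>auto intro: DERIV_subset[OF DERIV_exp]\<close>)
    also have "- (r * (real n * \<tau>)) - - (r * \<rho>) = - (r * (real n * \<tau> - \<rho>))"
      by (simp add: algebra_simps)
    also have "1 * norm (- (r * (real n * \<tau> - \<rho>))) = r * \<bar>real n * \<tau> - \<rho>\<bar>"
      using \<open>r > 0\<close> by (simp only: real_norm_def abs_minus_cancel abs_mult abs_of_pos mult_1)
    also have "\<dots> \<le> r * \<tau>"
      using assms by (intro mult_left_mono) (auto simp: \<tau>_def)
    finally show ?thesis by simp
  qed
  ultimately show ?thesis by (simp add: \<tau>_def)
qed

section \<open>Assembly of the uniform price estimate\<close>

context brownian
begin

lemma bs_price_eq_heat: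
  assumes "x > 0"
  shows "bs_price \<sigma> r T g M W t x =
    exp (- r * (T - t)) * heat (r - \<sigma>\<^sup>2 / 2) \<sigma> (T - t) (\<lambda>y. g (exp y)) (ln x)"
  using assms by (simp add: bs_price_def heat_def exp_add ac_simps)

text \<open>The terms are, in order: smoothing of the payoff in both models, the accumulated
  one-step errors, rounding of the remaining time to the grid, and the discount. None depends on
  \<open>t\<close> or \<open>x\<close>.\<close>

lemma discrete_price_uniform_bound:
  assumes "\<sigma> > 0" "r > 0" and adm: "admissible \<mu> \<sigma> r m"
    and F: "C3_bounded_by K F F1 F2 F3" and Fh: "\<And>y. \<bar>F y - g (exp y)\<bar> \<le> \<epsilon>"
    and h: "(\<lambda>y. g (exp y)) \<in> borel_measurable borel" and B: "\<And>y. \<bar>g (exp y)\<bar> \<le> B"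
    and t: "t \<in> {0..T}" and "x > 0"
  shows "\<bar>discrete_price \<mu> \<sigma> r T g m (grid_index m t) x - bs_price \<sigma> r T g M W t x\<bar> \<le>
    2 * \<epsilon> + (T * K * (2 ^ (2 * m) * consistency_error \<mu> \<sigma> r m)
      + K * (\<bar>r - \<sigma>\<^sup>2 / 2\<bar> * (1 / 2 ^ (2 * m)) + \<bar>\<sigma>\<bar> * sqrt (1 / 2 ^ (2 * m)))
      + (T * (2 ^ (2 * m) * \<bar>1 / rate_factor r m - exp (- r / 2 ^ (2 * m))\<bar>) + r / 2 ^ (2 * m)) * B)"
proof -
  define n where "n = grid_index m T - grid_index m t"
  define \<tau> :: real where "\<tau> = 1 / 2 ^ (2 * m)"
  define \<rho> where "\<rho> = T - t"
  define \<beta> where "\<beta> = r - \<sigma>\<^sup>2 / 2"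
  define e where "e = consistency_error \<mu> \<sigma> r m"
  define p a b where "p = q_plus \<mu> \<sigma> r m" and "a = ln (up_factor \<mu> \<sigma> m)" and "b = ln (down_factor \<mu> \<sigma> m)"
  let ?h = "\<lambda>y. g (exp y)" and ?y = "ln x"
  have "\<tau> > 0" by (simp add: \<tau>_def)
  have "0 \<le> \<rho>" using t by (simp add: \<rho>_def)
  have "0 \<le> K" using F unfolding C3_bounded_by_def by (meson abs_ge_zero order_trans)
  have "0 \<le> B" using B[of 0] by linarith
  have p: "0 \<le> p" "p \<le> 1" using adm by (auto simp: p_def admissible_def)
  have pos: "down_factor \<mu> \<sigma> m > 0" "up_factor \<mu> \<sigma> m > 0"
    using adm down_less_up[OF \<open>\<sigma> > 0\<close>, of \<mu> m] by (auto simp: admissible_def)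
  have n: "real n = real (grid_index m T) - real (grid_index m t)"
    using grid_index_mono[of t T m] t by (simp add: n_def)
  \<comment> \<open>Rounding down \<open>T\<close> and \<open>t\<close> loses less than one step
    each, and the two losses enter with opposite signs.\<close>
  have n_near: "\<bar>real n - \<rho> * 2 ^ (2 * m)\<bar> \<le> 1" and n_le: "real n \<le> T * 2 ^ (2 * m)"
    using grid_index_bounds[of t m] grid_index_bounds[of T m] t unfolding n \<rho>_def
    by (auto simp: left_diff_distrib)
  have n_rho: "\<bar>real n * \<tau> - \<rho>\<bar> \<le> \<tau>"
  proof -
    have "real n * \<tau> - \<rho> = (real n - \<rho> * 2 ^ (2 * m)) * \<tau>"
      by (simp add: \<tau>_def field_simps)
    then have "\<bar>real n * \<tau> - \<rho>\<bar> = \<bar>real n - \<rho> * 2 ^ (2 * m)\<bar> * \<tau>"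
      using \<open>\<tau> > 0\<close> by (simp add: abs_mult)
    with mult_right_mono[OF n_near, of \<tau>] \<open>\<tau> > 0\<close> show ?thesis by simp
  qed
  have FB: "\<And>y. \<bar>F y\<bar> \<le> K" using F by (simp add: C3_bounded_by_def)
  note F_meas = C3_borel_measurable[OF F]
  let ?A = "(shift_step p a b ^^ n) ?h ?y" and ?P = "heat \<beta> \<sigma> \<rho> ?h ?y"
  have "\<bar>(shift_step p a b ^^ n) F ?y - ?A\<bar> \<le> \<epsilon>"
    by (rule shift_step_funpow_contraction[OF p Fh])
  moreover have "\<bar>heat \<beta> \<sigma> \<rho> F ?y - ?P\<bar> \<le> \<epsilon>"
    using \<open>0 \<le> \<rho>\<close> F_meas h FB B Fh by (rule heat_contraction)
  moreover have "\<bar>(shift_step p a b ^^ n) F ?y - heat \<beta> \<sigma> (real n * \<tau>) F ?y\<bar> \<le> real n * (K * e)"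
  proof (rule shift_step_funpow_heat[OF _ F_meas FB p])
    show "\<bar>shift_step p a b F y - heat \<beta> \<sigma> \<tau> F y\<bar> \<le> K * e" for y
      using shift_step_heat_consistency[OF F p \<open>\<tau> > 0\<close>]
      by (simp only: e_def consistency_error_def Let_def p_def a_def b_def \<beta>_def \<tau>_def)
  qed (use \<open>\<tau> > 0\<close> in simp)
  moreover have "real n * (K * e) \<le> T * K * (2 ^ (2 * m) * e)"
  proof -
    have "0 \<le> e"
      using p \<open>\<tau> > 0\<close> unfolding e_def consistency_error_def Let_def p_def[symmetric] by simp
    then have "real n * (K * e) \<le> T * 2 ^ (2 * m) * (K * e)"
      using n_le \<open>0 \<le> K\<close> by (intro mult_right_mono) auto
    then show ?thesis by (simp add: ac_simps)
  qed
  moreover have "\<bar>heat \<beta> \<sigma> (real n * \<tau>) F ?y - heat \<beta> \<sigma> \<rho> F ?y\<bar> \<le> K * (\<bar>\<beta>\<bar> * \<tau> + \<bar>\<sigma>\<bar> * sqrt \<tau>)"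
  \<comment> \<open>\<open>heat_time_modulus\<close> takes its times in order, while the grid time
    may lie on either side of \<open>\<rho>\<close>.\<close>
  proof (cases "\<rho> \<le> real n * \<tau>")
    case True
    then show ?thesis
      using heat_time_modulus[OF F \<open>0 \<le> \<rho>\<close> True, of \<tau> \<beta> \<sigma> ?y] n_rho by simp
  next
    case False
    then show ?thesis
      using heat_time_modulus[OF F, of "real n * \<tau>" \<rho> \<tau> \<beta> \<sigma> ?y] n_rho \<open>\<tau> > 0\<close>
      by (simp add: abs_minus_commute)
  qed
  ultimately have AP: "\<bar>?A - ?P\<bar> \<le> 2 * \<epsilon> + (T * K * (2 ^ (2 * m) * e) + K * (\<bar>\<beta>\<bar> * \<tau> + \<bar>\<sigma>\<bar> * sqrt \<tau>))"
    by linarith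
  let ?D = "(1 / rate_factor r m) ^ n" and ?E = "exp (- r * \<rho>)"
  let ?c = "\<bar>1 / rate_factor r m - exp (- r / 2 ^ (2 * m))\<bar>"
  have "\<bar>?D - ?E\<bar> \<le> real n * ?c + r / 2 ^ (2 * m)"
    using n_rho by (intro discount_error[OF \<open>r > 0\<close> \<open>0 \<le> \<rho>\<close>]) (simp add: \<tau>_def)
  also have "\<dots> \<le> T * 2 ^ (2 * m) * ?c + r / 2 ^ (2 * m)"
    using n_le by (intro add_right_mono mult_right_mono) auto
  finally have DE: "\<bar>?D - ?E\<bar> \<le> T * (2 ^ (2 * m) * ?c) + r / 2 ^ (2 * m)"
    by (simp add: ac_simps)
  have "1 \<le> rate_factor r m" using \<open>r > 0\<close> by (simp add: rate_factor_def)
  then have D: "0 \<le> ?D" "?D \<le> 1"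
    by (auto intro!: power_le_one simp: divide_le_eq_1 simp del: power_one_over)
  have PB: "\<bar>?P\<bar> \<le> B"
    using \<open>0 \<le> \<rho>\<close> h B by (rule abs_heat_le)
  have "discrete_price \<mu> \<sigma> r T g m (grid_index m t) x = ?D * ?A"
  proof -
    have "int (grid_index m t) - int (grid_index m T) = - int n"
      using grid_index_mono[of t T m] t by (simp add: n_def)
    then have "rate_factor r m powi (int (grid_index m t) - int (grid_index m T)) = ?D"
      by (simp add: power_int_minus power_one_over inverse_eq_divide)
    then show ?thesis
      using binomial_step_funpow_exp[OF pos(2,1), where p=p and n=n and \<phi>=g and y="ln x"] \<open>x > 0\<close>
      by (simp add: discrete_price_eq_funpow p_def a_def b_def n_def)
  qed
  moreover have "bs_price \<sigma> r T g M W t x = ?E * ?P"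
    using bs_price_eq_heat[OF \<open>x > 0\<close>] by (simp add: \<rho>_def \<beta>_def)
  \<comment> \<open>The discount difference is paired with \<open>?P\<close>, bounded by
    \<open>B\<close>, and the price difference with \<open>?D\<close>, which is at most 1.\<close>
  moreover have "\<bar>?D * ?A - ?E * ?P\<bar> \<le> \<bar>?A - ?P\<bar> + \<bar>?D - ?E\<bar> * B"
  proof -
    have "\<bar>?D * ?A - ?E * ?P\<bar> = \<bar>?D * (?A - ?P) + (?D - ?E) * ?P\<bar>"
      by (simp add: algebra_simps)
    also have "\<dots> \<le> ?D * \<bar>?A - ?P\<bar> + \<bar>?D - ?E\<bar> * \<bar>?P\<bar>"
      using D by (auto simp: abs_mult intro: order_trans[OF abs_triangle_ineq])
    also have "\<dots> \<le> 1 * \<bar>?A - ?P\<bar> + \<bar>?D - ?E\<bar> * B"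
      using D PB by (intro add_mono mult_right_mono mult_left_mono) auto
    finally show ?thesis by simp
  qed
  moreover have "\<bar>?D - ?E\<bar> * B \<le> (T * (2 ^ (2 * m) * ?c) + r / 2 ^ (2 * m)) * B"
    using DE \<open>0 \<le> B\<close> by (rule mult_right_mono)
  ultimately show ?thesis
    using AP unfolding e_def \<beta>_def \<tau>_def by linarith
qed

text \<open>The smoothing is fixed first, at accuracy \<open>\<epsilon> / 3\<close>, which counts
  twice; only then does \<open>m\<close> grow, until the remaining terms, with \<open>K\<close> now
  constant, fall below the last third.\<close>

lemma discrete_price_uniform:
  assumes "\<sigma> > 0" "r > 0" and g: "g \<in> Cc_nonneg" and "\<epsilon> > 0"
  shows "\<forall>\<^sub>F m in sequentially. \<forall>t\<in>{0..T}. \<forall>x>0.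
    \<bar>discrete_price \<mu> \<sigma> r T g m (grid_index m t) x - bs_price \<sigma> r T g M W t x\<bar> < \<epsilon>"
proof -
  obtain B where B: "\<And>x. x \<ge> 0 \<Longrightarrow> \<bar>g x\<bar> \<le> B"
    using Cc_nonneg_bounded[OF g] by blast
  then have hB: "\<And>y. \<bar>g (exp y)\<bar> \<le> B" by simp
  note uc = Cc_nonneg_uniformly_continuous_exp[OF g]
  then have h: "(\<lambda>y. g (exp y)) \<in> borel_measurable borel"
    by (intro borel_measurable_continuous_onI uniformly_continuous_imp_continuous)
  obtain K F F1 F2 F3 where F: "C3_bounded_by K F F1 F2 F3" "\<And>y. \<bar>F y - g (exp y)\<bar> \<le> \<epsilon> / 3"
    using C3_approximation[OF uc hB divide_pos_pos[OF \<open>\<epsilon> > 0\<close>, of 3]] zero_less_numeral by blast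
  define \<delta> where "\<delta> m = T * K * (2 ^ (2 * m) * consistency_error \<mu> \<sigma> r m)
      + K * (\<bar>r - \<sigma>\<^sup>2 / 2\<bar> * (1 / 2 ^ (2 * m)) + \<bar>\<sigma>\<bar> * sqrt (1 / 2 ^ (2 * m)))
      + (T * (2 ^ (2 * m) * \<bar>1 / rate_factor r m - exp (- r / 2 ^ (2 * m))\<bar>) + r / 2 ^ (2 * m)) * B" for m
  have tau: "(\<lambda>m. 1 / 2 ^ (2 * m) :: real) \<longlonglongrightarrow> 0" by real_asymp
  have r_tau: "(\<lambda>m. r / 2 ^ (2 * m)) \<longlonglongrightarrow> 0" by real_asymp
  have "(\<lambda>m. sqrt (1 / 2 ^ (2 * m))) \<longlonglongrightarrow> 0"
    using tendsto_real_sqrt[OF tau] by simp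
  then have "\<delta> \<longlonglongrightarrow> 0"
    unfolding \<delta>_def using tau r_tau discount_error_limit[of r] consistency_error_limit[OF \<open>\<sigma> > 0\<close>, of \<mu> r]
    by (intro tendsto_add_zero tendsto_mult_right_zero tendsto_mult_left_zero)
  then have "\<forall>\<^sub>F m in sequentially. \<delta> m < \<epsilon> / 3"
    using \<open>\<epsilon> > 0\<close> by (intro order_tendstoD) auto
  then show ?thesis
    using eventually_admissible[OF \<open>\<sigma> > 0\<close>, of \<mu> r]
  proof eventually_elim
    case (elim m)
    show ?case
    proof (intro ballI allI impI)
      fix t x :: real assume "t \<in> {0..T}" "x > 0"
      from discrete_price_uniform_bound[OF \<open>\<sigma> > 0\<close> \<open>r > 0\<close> elim(2) F h hB this]
      show "\<bar>discrete_price \<mu> \<sigma> r T g m (grid_index m t) x - bs_price \<sigma> r T g M W t x\<bar> < \<epsilon>"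
        using elim(1) unfolding \<delta>_def by linarith
    qed
  qed
qed

end

subsection \<open>The conditional expectation in the Black--Scholes model\<close>

lemma bs_stock_pos: "s\<^sub>0 > 0 \<Longrightarrow> bs_stock \<sigma> r s\<^sub>0 W t \<omega> > 0"
  by (simp add: bs_stock_def)

context brownian
begin

lemma borel_measurable_bs_stock: "0 \<le> t \<Longrightarrow> bs_stock \<sigma> r s\<^sub>0 W t \<in> borel_measurable M"
  unfolding bs_stock_def by measurable

text \<open>Checked on the generating events: the indicator of such an event is a function of
  \<open>W t\<close>, so \<open>expectation_markov\<close> freezes the stock price at time
  \<open>t\<close> and averages over the later increment.\<close>

lemma bs_price_eq_cond_expectation:
  assumes g: "g \<in> Cc_nonneg" and "s\<^sub>0 > 0" and t: "t \<in> {0..T}"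
  shows "AE \<omega> in M.
    real_cond_exp M (vimage_algebra (space M) (bs_stock \<sigma> r s\<^sub>0 W t) borel)
      (\<lambda>\<omega>. exp (- r * (T - t)) * g (bs_stock \<sigma> r s\<^sub>0 W T \<omega>)) \<omega>
    = bs_price \<sigma> r T g M W t (bs_stock \<sigma> r s\<^sub>0 W t \<omega>)"
proof -
  have "0 \<le> t" "t \<le> T" "0 \<le> T" "0 \<le> T - t" using t by auto
  let ?S = "bs_stock \<sigma> r s\<^sub>0 W"
  let ?F = "vimage_algebra (space M) (?S t) borel"
  have [measurable]: "W t \<in> borel_measurable M" "W T \<in> borel_measurable M" "W (T - t) \<in> borel_measurable M"
    "?S t \<in> borel_measurable M" "?S T \<in> borel_measurable M"
    using \<open>0 \<le> t\<close> \<open>0 \<le> T\<close> \<open>t \<le> T\<close> by (auto intro: borel_measurable_bs_stock)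
  have "subalgebra M ?F"
    by (auto simp: subalgebra_def sets_vimage_algebra2 intro: measurable_sets)
  then interpret finite_measure_subalgebra M ?F
    by unfold_locales
  define \<phi> where "\<phi> x = g (max 0 x)" for x
  obtain B where B: "\<And>x. x \<ge> 0 \<Longrightarrow> \<bar>g x\<bar> \<le> B"
    using Cc_nonneg_bounded[OF g] by blast
  have [measurable]: "\<phi> \<in> borel_measurable borel"
    unfolding \<phi>_def by (rule borel_measurable_Cc_nonneg_max[OF g])
  have \<phi>_le: "\<bar>\<phi> x\<bar> \<le> B" for x using B by (simp add: \<phi>_def)
  have \<phi>_eq: "\<phi> x = g x" if "x > 0" for x using that by (simp add: \<phi>_def max_def)
  let ?b = "(r - \<sigma>\<^sup>2 / 2) * (T - t)" and ?D = "exp (- r * (T - t))"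
  \<comment> \<open>The Black--Scholes price with the truncated payoff: Borel and bounded on all
    reals, and equal to \<open>bs_price\<close> at positive \<open>x\<close>.\<close>
  define V where "V x = expectation (\<lambda>\<omega>. ?D * \<phi> (x * exp (?b + \<sigma> * W (T - t) \<omega>)))" for x
  have [measurable]: "V \<in> borel_measurable borel"
    unfolding V_def by measurable
  have V_le: "\<bar>V x\<bar> \<le> ?D * B" for x
  proof -
    have int: "integrable M (\<lambda>\<omega>. ?D * \<phi> (x * exp (?b + \<sigma> * W (T - t) \<omega>)))"
      by (rule integrable_const_bound[of _ "?D * B"]) (use \<phi>_le in \<open>auto simp: abs_mult\<close>)
    show ?thesis
      using expectation_diff_le[OF int, of "\<lambda>_. 0" "?D * B"] \<phi>_le by (simp add: V_def abs_mult)
  qed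
  have V_eq: "bs_price \<sigma> r T g M W t x = V x" if "x > 0" for x
    using that by (simp add: bs_price_def V_def \<phi>_eq)
  have S_T: "?S T \<omega> = ?S t \<omega> * exp (?b + \<sigma> * (W T \<omega> - W t \<omega>))" for \<omega>
    by (simp add: bs_stock_def exp_add[symmetric] field_simps)
  have "AE \<omega> in M. real_cond_exp M ?F (\<lambda>\<omega>. ?D * \<phi> (?S T \<omega>)) \<omega> = V (?S t \<omega>)"
  proof (rule real_cond_exp_charact)
    fix A assume "A \<in> sets ?F"
    then obtain C where [measurable]: "C \<in> sets borel" and A: "A = ?S t -` C \<inter> space M"
      by (auto simp: sets_vimage_algebra2)
    let ?f = "\<lambda>v w. indicator C (s\<^sub>0 * exp ((r - \<sigma>\<^sup>2 / 2) * t + \<sigma> * v)) *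
      (?D * \<phi> (s\<^sub>0 * exp ((r - \<sigma>\<^sup>2 / 2) * t + \<sigma> * v) * exp (?b + \<sigma> * w))) :: real"
    have "(\<integral>\<omega>\<in>A. ?D * \<phi> (?S T \<omega>) \<partial>M) = expectation (\<lambda>\<omega>. ?f (W t \<omega>) (W T \<omega> - W t \<omega>))"
      unfolding set_lebesgue_integral_def S_T
      by (intro Bochner_Integration.integral_cong) (auto simp: A indicator_def bs_stock_def)
    also have "\<dots> = expectation (\<lambda>\<omega>. expectation (\<lambda>\<omega>'. ?f (W t \<omega>) (W (T - t) \<omega>')))"
      using \<open>0 \<le> t\<close> \<open>t \<le> T\<close>
    proof (rule expectation_markov)
      show "case_prod ?f \<in> borel_measurable (borel \<Otimes>\<^sub>M borel)"
        by measurable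
      show "\<bar>?f v w\<bar> \<le> ?D * B" for v w
        using \<phi>_le B[of 0] by (auto simp: indicator_def abs_mult)
    qed
    also have "\<dots> = (\<integral>\<omega>\<in>A. V (?S t \<omega>) \<partial>M)"
      unfolding set_lebesgue_integral_def
      by (intro Bochner_Integration.integral_cong) (auto simp: A indicator_def bs_stock_def V_def)
    finally show "(\<integral>\<omega>\<in>A. ?D * \<phi> (?S T \<omega>) \<partial>M) = (\<integral>\<omega>\<in>A. V (?S t \<omega>) \<partial>M)" .
  next
    show "integrable M (\<lambda>\<omega>. ?D * \<phi> (?S T \<omega>))"
      by (rule integrable_const_bound[of _ "?D * B"]) (use \<phi>_le in \<open>auto simp: abs_mult\<close>)
    show "integrable M (\<lambda>\<omega>. V (?S t \<omega>))"
      by (rule integrable_const_bound[of _ "?D * B"]) (use V_le in auto)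
    show "(\<lambda>\<omega>. V (?S t \<omega>)) \<in> borel_measurable ?F"
      by (rule measurable_compose[OF measurable_vimage_algebra1]) auto
  qed
  moreover have "(\<lambda>\<omega>. ?D * \<phi> (?S T \<omega>)) = (\<lambda>\<omega>. ?D * g (?S T \<omega>))"
    by (simp add: \<phi>_eq[OF bs_stock_pos[OF \<open>s\<^sub>0 > 0\<close>]])
  ultimately show ?thesis
    by (simp add: V_eq[OF bs_stock_pos[OF \<open>s\<^sub>0 > 0\<close>]])
qed

end

section \<open>From the uniform estimate to the supremum\<close>

text \<open>Extended reals give the supremum a meaning for every \<open>m\<close>, even where the
  price difference is unbounded because \<open>m\<close> is not yet admissible.\<close>

lemma tendsto_SUP_ereal_abs:
  fixes f :: "nat \<Rightarrow> 'a \<Rightarrow> real"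
  assumes "A \<noteq> {}" and "\<And>\<epsilon>. \<epsilon> > 0 \<Longrightarrow> \<forall>\<^sub>F m in sequentially. \<forall>x\<in>A. \<bar>f m x\<bar> < \<epsilon>"
  shows "(\<lambda>m. SUP x\<in>A. ereal \<bar>f m x\<bar>) \<longlonglongrightarrow> 0"
proof (rule order_tendstoI)
  fix a :: ereal assume "a < 0"
  \<comment> \<open>Nonemptiness of \<open>A\<close> enters here: the supremum of the empty set
    would be minus infinity.\<close>
  moreover have "0 \<le> (SUP x\<in>A. ereal \<bar>f m x\<bar>)" for m
    using assms(1) by (auto intro: SUP_upper2)
  ultimately show "\<forall>\<^sub>F m in sequentially. a < (SUP x\<in>A. ereal \<bar>f m x\<bar>)"
    by (intro always_eventually allI) (rule less_le_trans)
next
  fix a :: ereal assume "0 < a"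
  \<comment> \<open>A real number strictly between 0 and \<open>a\<close>, because strict pointwise
    bounds give only a weak bound on the supremum.\<close>
  then obtain \<epsilon> where \<epsilon>: "0 < ereal \<epsilon>" "ereal \<epsilon> < a"
    using ereal_dense2 by blast
  then have "\<forall>\<^sub>F m in sequentially. \<forall>x\<in>A. \<bar>f m x\<bar> < \<epsilon>"
    using assms(2) by simp
  then show "\<forall>\<^sub>F m in sequentially. (SUP x\<in>A. ereal \<bar>f m x\<bar>) < a"
  proof eventually_elim
    case (elim m)
    then have "(SUP x\<in>A. ereal \<bar>f m x\<bar>) \<le> ereal \<epsilon>"
      by (intro SUP_least) (auto intro: less_imp_le)
    with \<epsilon> show ?case by simp
  qed
qed

theorem theorem1:
  fixes \<mu> \<sigma> r T s\<^sub>0 :: real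
    and g :: "real \<Rightarrow> real"
    and M :: "'a measure"
    and W :: "real \<Rightarrow> 'a \<Rightarrow> real"
  assumes "\<sigma> > 0" and "r > 0" and "T > 0" and "s\<^sub>0 > 0"
    and "g \<in> Cc_nonneg"
    and "brownian_motion M W"
  shows
    "(\<forall>m s x t (Q :: 'b measure) S.
       admissible \<mu> \<sigma> r m \<longrightarrow> s > 0 \<longrightarrow> discrete_stock \<mu> \<sigma> r T m s Q S \<longrightarrow>
       t \<in> {0..T} \<longrightarrow> x > 0 \<longrightarrow>
       measure Q {\<omega> \<in> space Q. S (grid_index m t) \<omega> = x} > 0 \<longrightarrow>
       discrete_price \<mu> \<sigma> r T g m (grid_index m t) x =
         (\<integral>\<omega>. rate_factor r m powi (\<lfloor>t * 2 ^ (2 * m)\<rfloor> - \<lfloor>T * 2 ^ (2 * m)\<rfloor>) *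
               g (S (grid_index m T) \<omega>)
          \<partial>uniform_measure Q {\<omega> \<in> space Q. S (grid_index m t) \<omega> = x})) \<and>
     (\<forall>t\<in>{0..T}. AE \<omega> in M.
       real_cond_exp M (vimage_algebra (space M) (bs_stock \<sigma> r s\<^sub>0 W t) borel)
         (\<lambda>\<omega>. exp (- r * (T - t)) * g (bs_stock \<sigma> r s\<^sub>0 W T \<omega>)) \<omega>
       = bs_price \<sigma> r T g M W t (bs_stock \<sigma> r s\<^sub>0 W t \<omega>)) \<and>
     uniform_limit ({0..T} \<times> {0<..})
       (\<lambda>m (t, x). discrete_price \<mu> \<sigma> r T g m (grid_index m t) x)
       (\<lambda>(t, x). bs_price \<sigma> r T g M W t x) sequentially \<and>
     (\<lambda>m. SUP (t, x) \<in> {0..T} \<times> {0<..}.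
            ereal \<bar>discrete_price \<mu> \<sigma> r T g m (grid_index m t) x - bs_price \<sigma> r T g M W t x\<bar>)
         \<longlonglongrightarrow> 0"
proof -
  interpret brownian M W by unfold_locales fact
  note unif = discrete_price_uniform[OF assms(1,2,5), where \<mu>=\<mu> and T=T]
  let ?X = "{0..T} \<times> {0::real<..}"
  have limit: "uniform_limit ?X
      (\<lambda>m (t, x). discrete_price \<mu> \<sigma> r T g m (grid_index m t) x)
      (\<lambda>(t, x). bs_price \<sigma> r T g M W t x) sequentially"
  proof (rule uniform_limitI)
    fix \<epsilon> :: real assume "\<epsilon> > 0"
    from unif[OF this] show "\<forall>\<^sub>F m in sequentially. \<forall>z\<in>?X.
        dist (case z of (t, x) \<Rightarrow> discrete_price \<mu> \<sigma> r T g m (grid_index m t) x)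
          (case z of (t, x) \<Rightarrow> bs_price \<sigma> r T g M W t x) < \<epsilon>"
      by eventually_elim (auto simp: dist_real_def)
  qed
  have "(\<lambda>m. SUP z \<in> ?X. ereal \<bar>case z of (t, x) \<Rightarrow>
      discrete_price \<mu> \<sigma> r T g m (grid_index m t) x - bs_price \<sigma> r T g M W t x\<bar>) \<longlonglongrightarrow> 0"
  proof (rule tendsto_SUP_ereal_abs)
    have "(0, 1) \<in> ?X" using \<open>T > 0\<close> by simp
    then show "?X \<noteq> {}" by blast
    fix \<epsilon> :: real assume "\<epsilon> > 0"
    from unif[OF this] show "\<forall>\<^sub>F m in sequentially. \<forall>z\<in>?X. \<bar>case z of (t, x) \<Rightarrow>
        discrete_price \<mu> \<sigma> r T g m (grid_index m t) x - bs_price \<sigma> r T g M W t x\<bar> < \<epsilon>"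
      by eventually_elim auto
  qed
  \<comment> \<open>Only the position of the pair pattern changes: inside the absolute value for the
    general lemma, outside for the theorem.\<close>
  also have "(\<lambda>m. SUP z \<in> ?X. ereal \<bar>case z of (t, x) \<Rightarrow>
      discrete_price \<mu> \<sigma> r T g m (grid_index m t) x - bs_price \<sigma> r T g M W t x\<bar>) =
    (\<lambda>m. SUP (t, x) \<in> ?X.
      ereal \<bar>discrete_price \<mu> \<sigma> r T g m (grid_index m t) x - bs_price \<sigma> r T g M W t x\<bar>)"
    by (intro ext SUP_cong) auto
  finally have sup: "\<dots> \<longlonglongrightarrow> 0" .
  show ?thesis
    using discrete_price_eq_cond_expectation[OF assms(5,1)]
      bs_price_eq_cond_expectation[OF assms(5,4)] limit sup
    by blast
qed

end
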